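(* Let $\mathcal{A}$ be a properly infinite von Neumann algebra, and let the sets below be taken with respect to the ideal $\mathfrak{m}$ of $\mathcal{A}$. Then $\mathcal{K}\Phi_{+}^{-}(\mathcal{A})\cap\mathcal{K}\Phi_{-}^{+}(\mathcal{A})\cap\mathcal{K}\Phi(\mathcal{A})=\mathcal{K}\Phi_{0}(\mathcal{A})$.
   Context: $\mathrm{Proj}_0(\mathcal{A})$ is the set of finite projections of $\mathcal{A}$ (projections not Murray-von Neumann equivalent to any proper subprojection). $\mathfrak{m}$ is the norm closure of the set of all $S\in\mathcal{A}$ such that the projection onto $\overline{\operatorname{Im}S}$ belongs to $\mathrm{Proj}_0(\mathcal{A})$; it is a selfadjoint ideal of $\mathcal{A}$. For projections $p,q\in\mathcal{A}$: $p\sim q$ means there is $v\in\mathcal{A}$ with $vv^*=p$, $v^*v=q$; $p\preceq q$ means there is a projection $p'\in\mathcal{A}$ with $p'\le q$ and $p\sim p'$. For $a\in\mathcal{A}$ and projections $p,q\in\mathcal{A}$, $a$ is invertible up to the pair $(p,q)$ if, with $a'=(1-q)a(1-p)$, there is $b\in\mathcal{A}$ with $b=(1-p)b(1-q)$, $a'b=1-q$, $ba'=1-p$. $\mathcal{K}\Phi(\mathcal{A})$ (Fredholm type), resp. $\mathcal{K}\Phi_{+}^{-}(\mathcal{A})$ (upper semi-Weyl type), resp. $\mathcal{K}\Phi_{-}^{+}(\mathcal{A})$ (lower semi-Weyl type), resp. $\mathcal{K}\Phi_{0}(\mathcal{A})$ (Weyl type), is the set of $a\in\mathcal{A}$ that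 are invertible up to some pair $(p,q)$ of projections in $\mathcal{A}$ with $p,q\in\mathfrak{m}$, resp. $p\in\mathfrak{m}$ and $p\preceq q$, resp. $q\in\mathfrak{m}$ and $q\preceq p$, resp. $p,q\in\mathfrak{m}$ and $p\sim q$. *)

theory Defs
  imports "HOL-Analysis.Analysis"
begin

text \<open>
  Complex Hilbert spaces, with an inner product that is linear in its first argument. The real
  structure of the superclasses is the underlying one, so the norm is the square root of
  \<^term>\<open>Re (cinner x x)\<close>, and positive definiteness of \<open>cinner\<close> is inherited from \<open>inner\<close>.
\<close>

class complex_hilbert = real_inner + complete_space +
  fixes scaleC :: "complex \<Rightarrow> 'a \<Rightarrow> 'a"  (infixr \<open>*\<^sub>C\<close> 75)
    and cinner :: "'a \<Rightarrow> 'a \<Rightarrow> complex"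
  assumes scaleC_add_right: "c *\<^sub>C (x + y) = c *\<^sub>C x + c *\<^sub>C y"
    and scaleC_add_left: "(c + d) *\<^sub>C x = c *\<^sub>C x + d *\<^sub>C x"
    and scaleC_scaleC: "c *\<^sub>C d *\<^sub>C x = (c * d) *\<^sub>C x"
    and scaleC_of_real: "complex_of_real r *\<^sub>C x = r *\<^sub>R x"
    and cinner_add_left: "cinner (x + y) z = cinner x z + cinner y z"
    and cinner_scaleC_left: "cinner (c *\<^sub>C x) y = c * cinner x y"
    and cinner_commute: "cinner x y = cnj (cinner y x)"
    and Re_cinner: "Re (cinner x y) = inner x y"

instantiation complex :: complex_hilbert
begin

definition scaleC_complex :: "complex \<Rightarrow> complex \<Rightarrow> complex"
  where "scaleC_complex c x = c * x"

definition cinner_complex :: "complex \<Rightarrow> complex \<Rightarrow> complex"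
  where "cinner_complex x y = x * cnj y"

instance
  by standard
    (simp_all add: scaleC_complex_def cinner_complex_def inner_complex_def
      scaleR_conv_of_real algebra_simps)

end

text \<open>
  The type \<open>'h \<Rightarrow>\<^sub>L 'h\<close> consists of the bounded real-linear operators; \<open>bounded_ops\<close> is \<open>B(H)\<close>.
  The real operator norm agrees with the usual norm of \<open>B(H)\<close>.
\<close>

definition bounded_ops :: "('h::complex_hilbert \<Rightarrow>\<^sub>L 'h) set"
  where "bounded_ops = {T. \<forall>c x. blinfun_apply T (c *\<^sub>C x) = c *\<^sub>C blinfun_apply T x}"

definition adj :: "('h::complex_hilbert \<Rightarrow>\<^sub>L 'h) \<Rightarrow> ('h \<Rightarrow>\<^sub>L 'h)"
  where "adj T = (THE S. \<forall>x y.
    cinner (blinfun_apply S x) y = cinner x (blinfun_apply T y))"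

definition commutant :: "('h::complex_hilbert \<Rightarrow>\<^sub>L 'h) set \<Rightarrow> ('h \<Rightarrow>\<^sub>L 'h) set"
  where "commutant S = {T \<in> bounded_ops. \<forall>s\<in>S. T o\<^sub>L s = s o\<^sub>L T}"

text \<open>
  A commutant is always a complex subalgebra of \<open>B(H)\<close> containing the identity, so the bicommutant
  condition makes \<open>A\<close> a unital *-subalgebra.
\<close>

definition von_neumann_algebra :: "('h::complex_hilbert \<Rightarrow>\<^sub>L 'h) set \<Rightarrow> bool"
  where "von_neumann_algebra A \<longleftrightarrow>
    A \<subseteq> bounded_ops \<and> (\<forall>a\<in>A. adj a \<in> A) \<and> commutant (commutant A) = A"

definition Proj :: "('h::complex_hilbert \<Rightarrow>\<^sub>L 'h) set \<Rightarrow> ('h \<Rightarrow>\<^sub>L 'h) set"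
  where "Proj A = {p \<in> A. p o\<^sub>L p = p \<and> adj p = p}"

definition subproj :: "('h::complex_hilbert \<Rightarrow>\<^sub>L 'h) \<Rightarrow> ('h \<Rightarrow>\<^sub>L 'h) \<Rightarrow> bool"
  where "subproj p q \<longleftrightarrow> p o\<^sub>L q = p"

definition mvn_equiv ::
    "('h::complex_hilbert \<Rightarrow>\<^sub>L 'h) set \<Rightarrow> ('h \<Rightarrow>\<^sub>L 'h) \<Rightarrow> ('h \<Rightarrow>\<^sub>L 'h) \<Rightarrow> bool"
  where "mvn_equiv A p q \<longleftrightarrow> (\<exists>v\<in>A. v o\<^sub>L adj v = p \<and> adj v o\<^sub>L v = q)"

definition mvn_le ::
    "('h::complex_hilbert \<Rightarrow>\<^sub>L 'h) set \<Rightarrow> ('h \<Rightarrow>\<^sub>L 'h) \<Rightarrow> ('h \<Rightarrow>\<^sub>L 'h) \<Rightarrow> bool"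
  where "mvn_le A p q \<longleftrightarrow> (\<exists>p'\<in>Proj A. subproj p' q \<and> mvn_equiv A p p')"

definition Proj\<^sub>0 :: "('h::complex_hilbert \<Rightarrow>\<^sub>L 'h) set \<Rightarrow> ('h \<Rightarrow>\<^sub>L 'h) set"
  where "Proj\<^sub>0 A =
    {p \<in> Proj A. \<not> (\<exists>p'\<in>Proj A. subproj p' p \<and> p' \<noteq> p \<and> mvn_equiv A p p')}"

definition properly_infinite :: "('h::complex_hilbert \<Rightarrow>\<^sub>L 'h) set \<Rightarrow> bool"
  where "properly_infinite A \<longleftrightarrow> (\<forall>z \<in> Proj A \<inter> commutant A. z \<in> Proj\<^sub>0 A \<longrightarrow> z = 0)"

definition fin_ideal :: "('h::complex_hilbert \<Rightarrow>\<^sub>L 'h) set \<Rightarrow> ('h \<Rightarrow>\<^sub>L 'h) set"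
  where "fin_ideal A = closure {S \<in> A. \<exists>p \<in> Proj\<^sub>0 A.
    range (blinfun_apply p) = closure (range (blinfun_apply S))}"

definition invertible_upto ::
    "('h::complex_hilbert \<Rightarrow>\<^sub>L 'h) set \<Rightarrow> ('h \<Rightarrow>\<^sub>L 'h) \<Rightarrow> ('h \<Rightarrow>\<^sub>L 'h) \<Rightarrow> ('h \<Rightarrow>\<^sub>L 'h) \<Rightarrow> bool"
  where "invertible_upto A a p q \<longleftrightarrow>
    (let a' = (id_blinfun - q) o\<^sub>L a o\<^sub>L (id_blinfun - p) in
      \<exists>b\<in>A. b = (id_blinfun - p) o\<^sub>L b o\<^sub>L (id_blinfun - q) \<and>
        a' o\<^sub>L b = id_blinfun - q \<and> b o\<^sub>L a' = id_blinfun - p)"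

definition K\<Phi> :: "('h::complex_hilbert \<Rightarrow>\<^sub>L 'h) set \<Rightarrow> ('h \<Rightarrow>\<^sub>L 'h) set"
  where "K\<Phi> A = {a \<in> A. \<exists>p\<in>Proj A. \<exists>q\<in>Proj A.
    invertible_upto A a p q \<and> p \<in> fin_ideal A \<and> q \<in> fin_ideal A}"

definition K\<Phi>_upper_semi_Weyl :: "('h::complex_hilbert \<Rightarrow>\<^sub>L 'h) set \<Rightarrow> ('h \<Rightarrow>\<^sub>L 'h) set"
  where "K\<Phi>_upper_semi_Weyl A = {a \<in> A. \<exists>p\<in>Proj A. \<exists>q\<in>Proj A.
    invertible_upto A a p q \<and> p \<in> fin_ideal A \<and> mvn_le A p q}"

definition K\<Phi>_lower_semi_Weyl :: "('h::complex_hilbert \<Rightarrow>\<^sub>L 'h) set \<Rightarrow> ('h \<Rightarrow>\<^sub>L 'h) set"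
  where "K\<Phi>_lower_semi_Weyl A = {a \<in> A. \<exists>p\<in>Proj A. \<exists>q\<in>Proj A.
    invertible_upto A a p q \<and> q \<in> fin_ideal A \<and> mvn_le A q p}"

definition K\<Phi>\<^sub>0 :: "('h::complex_hilbert \<Rightarrow>\<^sub>L 'h) set \<Rightarrow> ('h \<Rightarrow>\<^sub>L 'h) set"
  where "K\<Phi>\<^sub>0 A = {a \<in> A. \<exists>p\<in>Proj A. \<exists>q\<in>Proj A.
    invertible_upto A a p q \<and> p \<in> fin_ideal A \<and> q \<in> fin_ideal A \<and> mvn_equiv A p q}"

end

theory Submission
  imports Defs
begin

text \<open>
  A projection in the closed ideal generated by the finite projections is itself finite, because an
  operator at distance less than one from it compresses to an operator with the same range
  projection. Let \<open>a\<close> be invertible up to \<open>(p, q)\<close> with \<open>p \<preceq> q\<close>, and up to \<open>(p', q')\<close> with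
  \<open>q' \<preceq> p'\<close>, all relevant projections being finite (the Fredholm condition forces \<open>q\<close> to be finite).
  Adding to the invertible corners of \<open>a\<close> partial isometries that implement \<open>p \<preceq> q\<close> and
  \<open>q' \<preceq> p'\<close> gives a left invertible \<open>c\<close>, whose range misses exactly the part \<open>s\<close> of \<open>q\<close> not
  reached from \<open>p\<close>, and a right invertible operator with right inverse \<open>d\<close>; both are finite-rank
  perturbations of \<open>a\<close>. So \<open>c d\<close> is injective and a finite-rank perturbation of the identity,
  hence has dense range by the Fredholm alternative in a finite corner; as \<open>s c d = 0\<close>, this
  gives \<open>s = 0\<close>, that is \<open>p \<sim> q\<close>.

  The operators of finite range projection form an ideal because the join of two finite projections is
  finite. This follows from cancellation: equivalent finite projections below \<open>N\<close> have
  equivalent complements in \<open>N\<close>, which the parallelogram law reduces to complements inside a finite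
  projection, where a maximal pair of equivalent parts together with a central support does the job.

  Operators are treated as real-linear ones throughout: their adjoint \<open>T\<^sup>\<dagger>\<close> is defined without
  side conditions and agrees with \<open>adj\<close> on complex-linear operators, where \<open>adj\<close> is meaningful.
\<close>

subsection \<open>Orthogonal decomposition and adjoints\<close>

instance complex_hilbert \<subseteq> banach ..

abbreviation op_comp :: "('a::real_normed_vector \<Rightarrow>\<^sub>L 'a) \<Rightarrow> ('a \<Rightarrow>\<^sub>L 'a) \<Rightarrow> ('a \<Rightarrow>\<^sub>L 'a)"
    (infixl \<open>\<odot>\<close> 70)
  where "S \<odot> T \<equiv> S o\<^sub>L T"

text \<open>A minimizing sequence for the distance from \<open>x\<close> to \<open>S\<close> is
  Cauchy by the parallelogram identity. Its limit is a nearest point, and comparing it with the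
  points \<open>y0 + t *\<^sub>R z\<close> of \<open>S\<close> forces orthogonality.\<close>

lemma orthogonal_decomposition_exists:
  fixes S :: "'a::{real_inner,banach} set"
  assumes S: "subspace S" "closed S"
  shows "\<exists>y\<in>S. \<forall>z\<in>S. inner (x - y) z = 0"
proof -
  define D where "D = (\<lambda>z. (norm (x - z))\<^sup>2) ` S"
  define d where "d = Inf D"
  have Dne: "D \<noteq> {}" using subspace_0[OF S(1)] by (auto simp: D_def)
  have Dbb: "bdd_below D" by (auto simp: D_def intro!: bdd_belowI[of _ 0])
  have d_le: "d \<le> (norm (x - z))\<^sup>2" if "z \<in> S" for z
    unfolding d_def using that Dbb by (auto simp: D_def intro!: cInf_lower)
  have "\<exists>z\<in>S. (norm (x - z))\<^sup>2 < d + 1 / (real n + 1)" for n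
    using cInf_lessD[OF Dne, of "d + 1 / (real n + 1)"] by (auto simp: d_def D_def)
  then obtain y where y: "\<And>n. y n \<in> S" "\<And>n. (norm (x - y n))\<^sup>2 < d + 1 / (real n + 1)"
    by metis
  \<comment> \<open>The midpoint of \<open>y m\<close> and \<open>y n\<close> lies in
    \<open>S\<close>, so its squared distance to \<open>x\<close> is at least \<open>d\<close>; the
    parallelogram identity turns this into a bound on the distance of \<open>y m\<close> and
    \<open>y n\<close>.\<close>
  have close: "(norm (y m - y n))\<^sup>2 \<le> 2 / (real m + 1) + 2 / (real n + 1)" for m n
  proof -
    have "(1/2) *\<^sub>R (y m + y n) \<in> S"
      using y(1) S(1) by (auto intro: subspace_scale subspace_add)
    from d_le[OF this] have "4 * d \<le> 4 * (norm (x - (1/2) *\<^sub>R (y m + y n)))\<^sup>2" by simp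
    also have "\<dots> = (norm (2 *\<^sub>R (x - (1/2) *\<^sub>R (y m + y n))))\<^sup>2"
      by (simp add: power_mult_distrib)
    also have "\<dots> = (norm ((x - y m) + (x - y n)))\<^sup>2"
      by (simp add: algebra_simps scaleR_2)
    also have "\<dots> = 2 * (norm (x - y m))\<^sup>2 + 2 * (norm (x - y n))\<^sup>2 - (norm (y m - y n))\<^sup>2"
      by (simp add: power2_norm_eq_inner inner_simps inner_commute algebra_simps)
    finally show ?thesis using y(2)[of m] y(2)[of n] by simp
  qed
  have "Cauchy y"
  proof (rule metric_CauchyI)
    fix e :: real assume e: "0 < e"
    obtain N where N: "4 / e\<^sup>2 < real N" using reals_Archimedean2 by blast
    show "\<exists>M. \<forall>m\<ge>M. \<forall>n\<ge>M. dist (y m) (y n) < e"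
    proof (intro exI allI impI)
      fix m n assume mn: "N \<le> m" "N \<le> n"
      have b: "2 / (real k + 1) < e\<^sup>2 / 2" if "N \<le> k" for k
      proof -
        have "4 / e\<^sup>2 < real k + 1" using N that by linarith
        then show ?thesis using e by (simp add: field_simps)
      qed
      have "(norm (y m - y n))\<^sup>2 < e\<^sup>2"
        using close[of m n] b[OF mn(1)] b[OF mn(2)] by linarith
      then show "dist (y m) (y n) < e"
        using e by (metis dist_norm less_imp_le power_less_imp_less_base)
    qed
  qed
  then obtain y0 where y0: "y \<longlonglongrightarrow> y0"
    using Cauchy_convergent convergent_def by blast
  have y0S: "y0 \<in> S" using S(2) y(1) y0 closed_sequentially by blast
  have "(\<lambda>n. (norm (x - y n))\<^sup>2) \<longlonglongrightarrow> (norm (x - y0))\<^sup>2"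
    by (intro tendsto_intros y0)
  moreover have "(\<lambda>n. d + 1 / (real n + 1)) \<longlonglongrightarrow> d + 0"
    by (intro tendsto_intros) (use LIMSEQ_inverse_real_of_nat in \<open>simp add: inverse_eq_divide add.commute\<close>)
  ultimately have min: "(norm (x - y0))\<^sup>2 \<le> d"
    using LIMSEQ_le[of "\<lambda>n. (norm (x - y n))\<^sup>2" "(norm (x - y0))\<^sup>2" "\<lambda>n. d + 1 / (real n + 1)" "d + 0"]
      y(2) less_imp_le by auto
  show ?thesis
  proof (intro bexI[OF _ y0S] ballI)
    fix z assume z: "z \<in> S"
    show "inner (x - y0) z = 0"
    proof (cases "z = 0")
      case False
      \<comment> \<open>This value minimizes the squared distance from \<open>x\<close> to
        \<open>y0 + t *\<^sub>R z\<close>, which then drops by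
        \<open>(inner (x - y0) z)\<^sup>2 / inner z z\<close>.\<close>
      define t where "t = inner (x - y0) z / (inner z z)"
      have "(norm (x - y0))\<^sup>2 \<le> (norm (x - (y0 + t *\<^sub>R z)))\<^sup>2"
        using min d_le[OF subspace_add[OF S(1) y0S subspace_scale[OF S(1) z, of t]]] by linarith
      also have "\<dots> = (norm (x - y0))\<^sup>2 - 2 * t * inner (x - y0) z + t\<^sup>2 * inner z z"
        unfolding power2_norm_eq_inner
        by (simp add: inner_simps inner_commute algebra_simps power2_eq_square)
      also have "\<dots> = (norm (x - y0))\<^sup>2 - (inner (x - y0) z)\<^sup>2 / inner z z"
        using False by (simp add: t_def power2_eq_square field_simps)
      finally have "(inner (x - y0) z)\<^sup>2 / inner z z \<le> 0" by simp
      moreover have "0 < inner z z" using False by simp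
      ultimately have "(inner (x - y0) z)\<^sup>2 \<le> 0" by (simp add: divide_le_0_iff)
      then show ?thesis by simp
    qed simp
  qed
qed

section \<open>Orthogonal projections onto closed subspaces\<close>

definition proj :: "'a::{real_inner,banach} set \<Rightarrow> ('a \<Rightarrow>\<^sub>L 'a)"
  where "proj S = Blinfun (\<lambda>x. THE y. y \<in> S \<and> (\<forall>z\<in>S. inner (x - y) z = 0))"

text \<open>The difference of two candidates lies in \<open>S\<close> and is orthogonal to
  itself.\<close>

lemma orthogonal_decomposition_unique:
  fixes S :: "'a::real_inner set"
  assumes "subspace S" "y \<in> S" "\<And>z. z \<in> S \<Longrightarrow> inner (x - y) z = 0"
    and "y' \<in> S" "\<And>z. z \<in> S \<Longrightarrow> inner (x - y') z = 0"
  shows "y = y'"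
proof -
  have "y - y' \<in> S" using assms subspace_diff by blast
  then have "inner (x - y') (y - y') - inner (x - y) (y - y') = 0" using assms by simp
  then have "inner (y - y') (y - y') = 0" by (simp add: inner_simps)
  then show ?thesis by simp
qed

text \<open>Uniqueness of the decomposition gives linearity, and Cauchy-Schwarz applied to
  \<open>(norm (f x))\<^sup>2 = inner x (f x)\<close> gives boundedness; this is what makes
  \<open>Blinfun\<close> in the definition of \<open>proj\<close> return the described map.\<close>

lemma
  fixes S :: "'a::{real_inner,banach} set"
  assumes S: "subspace S" "closed S"
  shows proj_in: "blinfun_apply (proj S) x \<in> S"
    and proj_orth: "z \<in> S \<Longrightarrow> inner (x - blinfun_apply (proj S) x) z = 0"
proof -
  define f where "f x = (THE y. y \<in> S \<and> (\<forall>z\<in>S. inner (x - y) z = 0))" for x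
  have f: "f x \<in> S \<and> (\<forall>z\<in>S. inner (x - f x) z = 0)" for x
  proof -
    have "\<exists>!y. y \<in> S \<and> (\<forall>z\<in>S. inner (x - y) z = 0)"
      using orthogonal_decomposition_exists[OF S, of x] orthogonal_decomposition_unique[OF S(1)]
      by blast
    then show ?thesis unfolding f_def by (rule theI')
  qed
  note uniq = orthogonal_decomposition_unique[OF S(1), OF conjunct1[OF f] conjunct2[OF f, THEN bspec]]
  have "bounded_linear f"
  proof (rule bounded_linear_intro[of _ 1])
    fix x y show "f (x + y) = f x + f y"
    proof (rule uniq)
      show "f x + f y \<in> S" using f S(1) by (simp add: subspace_add)
      fix z assume "z \<in> S"
      then show "inner (x + y - (f x + f y)) z = 0"
        using f[of x] f[of y] by (simp add: inner_simps)
    qed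
  next
    fix r x show "f (r *\<^sub>R x) = r *\<^sub>R f x"
    proof (rule uniq)
      show "r *\<^sub>R f x \<in> S" using f S(1) by (simp add: subspace_scale)
      fix z assume "z \<in> S"
      then show "inner (r *\<^sub>R x - r *\<^sub>R f x) z = 0"
        using f[of x] by (simp add: inner_simps)
    qed
  next
    fix x
    have "(norm (f x))\<^sup>2 = inner x (f x)"
      using f[of x] by (simp add: inner_simps power2_norm_eq_inner)
    also have "\<dots> \<le> norm x * norm (f x)" by (rule norm_cauchy_schwarz)
    finally have "norm (f x) * norm (f x) \<le> norm x * norm (f x)" by (simp add: power2_eq_square)
    then show "norm (f x) \<le> norm x * 1"
      by (cases "norm (f x) = 0") (simp_all add: mult_le_cancel_right)
  qed
  then have "blinfun_apply (proj S) = f"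
    unfolding proj_def f_def by (simp add: bounded_linear_Blinfun_apply)
  then show "blinfun_apply (proj S) x \<in> S"
    "z \<in> S \<Longrightarrow> inner (x - blinfun_apply (proj S) x) z = 0" using f by auto
qed

lemma proj_eqI:
  fixes S :: "'a::{real_inner,banach} set"
  assumes "subspace S" "closed S" "y \<in> S" "\<And>z. z \<in> S \<Longrightarrow> inner (x - y) z = 0"
  shows "blinfun_apply (proj S) x = y"
  using orthogonal_decomposition_unique[OF assms(1) proj_in[OF assms(1,2)] proj_orth[OF assms(1,2)] assms(3,4)]
  by blast

lemma proj_fixed_iff:
  fixes S :: "'a::{real_inner,banach} set"
  assumes "subspace S" "closed S"
  shows "blinfun_apply (proj S) x = x \<longleftrightarrow> x \<in> S"
  using proj_in[OF assms, of x] proj_eqI[OF assms, of x x] by auto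

lemma range_proj:
  fixes S :: "'a::{real_inner,banach} set"
  assumes "subspace S" "closed S"
  shows "range (blinfun_apply (proj S)) = S"
proof
  show "S \<subseteq> range (blinfun_apply (proj S))"
    using proj_fixed_iff[OF assms] by (metis rangeI subsetI)
qed (use proj_in[OF assms] in auto)

text \<open>For nonzero \<open>f\<close> the kernel is a closed hyperplane, and the representing
  vector is a multiple of the component \<open>u\<close> orthogonal to it of a point
  outside.\<close>

lemma riesz_representation:
  fixes f :: "'a::{real_inner,banach} \<Rightarrow> real"
  assumes f: "bounded_linear f"
  shows "\<exists>y. \<forall>x. f x = inner x y"
proof (cases "\<forall>x. f x = 0")
  case True then show ?thesis by (intro exI[of _ 0]) simp
next
  case False
  then obtain x0 where x0: "f x0 \<noteq> 0" by blast
  interpret f: bounded_linear f by (rule f)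
  define S where "S = {x. f x = 0}"
  have S: "subspace S" by (auto simp: S_def subspace_def f.zero f.add f.scaleR)
  have cS: "closed S" unfolding S_def
    by (intro closed_Collect_eq continuous_intros linear_continuous_on f)
  define u where "u = x0 - blinfun_apply (proj S) x0"
  have fu: "f u \<noteq> 0" using proj_in[OF S cS, of x0] x0 by (simp add: u_def f.diff S_def)
  then have u0: "u \<noteq> 0" using f.zero by auto
  show ?thesis
  proof (intro exI allI)
    fix x
    \<comment> \<open>Subtracting the right multiple of \<open>u\<close> moves \<open>x\<close> into
      the kernel, hence into the orthogonal complement of \<open>u\<close>.\<close>
    have "x - (f x / f u) *\<^sub>R u \<in> S" using fu by (simp add: S_def f.diff f.scaleR)
    then have "inner u (x - (f x / f u) *\<^sub>R u) = 0" unfolding u_def by (rule proj_orth[OF S cS])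
    then show "f x = inner x ((f u / inner u u) *\<^sub>R u)"
      using fu u0 by (simp add: inner_simps inner_commute field_simps)
  qed
qed

section \<open>Adjoints with respect to the real inner product\<close>

definition hadj :: "('a::{real_inner,banach} \<Rightarrow>\<^sub>L 'a) \<Rightarrow> ('a \<Rightarrow>\<^sub>L 'a)"  (\<open>_\<^sup>\<dagger>\<close> [1000] 1000)
  where "T\<^sup>\<dagger> = Blinfun (\<lambda>y. SOME w. \<forall>x. inner (blinfun_apply T x) y = inner x w)"

lemma inner_eqI:
  fixes u v :: "'a::real_inner"
  assumes "\<And>x. inner x u = inner x v" shows "u = v"
  by (metis assms inner_diff_right inner_eq_zero_iff right_minus_eq)

text \<open>Riesz representation supplies the chosen vectors \<open>g y\<close>. They depend
  linearly on \<open>y\<close> because inner products separate points, and boundedly because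
  \<open>(norm (g x))\<^sup>2\<close> is the inner product of \<open>T \<cdot> g x\<close> and
  \<open>x\<close>.\<close>

lemma hadj_right: "inner x (blinfun_apply (T\<^sup>\<dagger>) y) = inner (blinfun_apply T x) y"
proof -
  define g where "g y = (SOME w. \<forall>x. inner (blinfun_apply T x) y = inner x w)" for y
  have "bounded_linear (\<lambda>x. inner (blinfun_apply T x) y)" for y
    by (intro bounded_linear_inner_left_comp blinfun.bounded_linear_right)
  from riesz_representation[OF this]
  have "\<forall>x. inner (blinfun_apply T x) y = inner x (g y)" for y
    unfolding g_def by (rule someI_ex)
  then have g: "inner x (g y) = inner (blinfun_apply T x) y" for x y by metis
  have "bounded_linear g"
  proof (rule bounded_linear_intro[of _ "norm T"])
    fix x y show "g (x + y) = g x + g y" by (rule inner_eqI) (simp add: g inner_simps)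
  next
    fix r x show "g (r *\<^sub>R x) = r *\<^sub>R g x" by (rule inner_eqI) (simp add: g inner_simps)
  next
    fix x
    have "(norm (g x))\<^sup>2 = inner (blinfun_apply T (g x)) x" unfolding power2_norm_eq_inner by (rule g)
    also have "\<dots> \<le> norm (blinfun_apply T (g x)) * norm x" by (rule norm_cauchy_schwarz)
    also have "\<dots> \<le> norm T * norm (g x) * norm x" by (intro mult_right_mono norm_blinfun) simp
    finally have "norm (g x) * norm (g x) \<le> (norm x * norm T) * norm (g x)"
      by (simp add: power2_eq_square mult_ac)
    then show "norm (g x) \<le> norm x * norm T"
      by (cases "norm (g x) = 0") (simp_all add: mult_le_cancel_right)
  qed
  then show ?thesis unfolding hadj_def g_def[symmetric] by (simp add: bounded_linear_Blinfun_apply g)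
qed

lemma hadj_left: "inner (blinfun_apply (T\<^sup>\<dagger>) y) x = inner y (blinfun_apply T x)"
  by (metis hadj_right inner_commute)

lemma hadj_eqI:
  assumes "\<And>x y. inner x (blinfun_apply S y) = inner (blinfun_apply T x) y"
  shows "T\<^sup>\<dagger> = S"
  by (rule blinfun_eqI, rule inner_eqI) (simp add: assms hadj_right)

lemma hadj_hadj [simp]: "T\<^sup>\<dagger>\<^sup>\<dagger> = T"
  by (rule hadj_eqI) (simp add: hadj_left)
lemma hadj_add [simp]: "(S + T)\<^sup>\<dagger> = S\<^sup>\<dagger> + T\<^sup>\<dagger>"
  by (rule hadj_eqI) (simp add: hadj_right blinfun.bilinear_simps inner_simps)
lemma hadj_diff [simp]: "(S - T)\<^sup>\<dagger> = S\<^sup>\<dagger> - T\<^sup>\<dagger>"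
  by (rule hadj_eqI) (simp add: hadj_right blinfun.bilinear_simps inner_simps)
lemma hadj_scaleR [simp]: "(r *\<^sub>R T)\<^sup>\<dagger> = r *\<^sub>R T\<^sup>\<dagger>"
  by (rule hadj_eqI) (simp add: hadj_right blinfun.bilinear_simps inner_simps)
lemma hadj_comp [simp]: "(S \<odot> T)\<^sup>\<dagger> = T\<^sup>\<dagger> \<odot> S\<^sup>\<dagger>"
  by (rule hadj_eqI) (simp add: hadj_right)
lemma hadj_id [simp]: "(id_blinfun)\<^sup>\<dagger> = id_blinfun"
  by (rule hadj_eqI) simp
lemma hadj_zero [simp]: "0\<^sup>\<dagger> = 0"
  by (rule hadj_eqI) simp

lemma norm_hadj_le: "norm (T\<^sup>\<dagger>) \<le> norm T"
proof (rule norm_blinfun_bound)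
  fix x
  let ?y = "blinfun_apply (T\<^sup>\<dagger>) x"
  have "(norm ?y)\<^sup>2 = inner (blinfun_apply T ?y) x" unfolding power2_norm_eq_inner by (rule hadj_right)
  also have "\<dots> \<le> norm (blinfun_apply T ?y) * norm x" by (rule norm_cauchy_schwarz)
  also have "\<dots> \<le> norm T * norm ?y * norm x" by (intro mult_right_mono norm_blinfun) simp
  finally have "norm ?y * norm ?y \<le> (norm T * norm x) * norm ?y"
    by (simp add: power2_eq_square mult_ac)
  then show "norm ?y \<le> norm T * norm x"
    by (cases "norm ?y = 0") (simp_all add: mult_le_cancel_right)
qed simp

lemma norm_hadj [simp]: "norm (T\<^sup>\<dagger>) = norm T"
  using norm_hadj_le[of T] norm_hadj_le[of "T\<^sup>\<dagger>"] by simp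

lemma
  fixes S :: "'a::{real_inner,banach} set"
  assumes S: "subspace S" "closed S"
  shows proj_idem: "proj S \<odot> proj S = proj S" and proj_hadj: "(proj S)\<^sup>\<dagger> = proj S"
proof -
  show "proj S \<odot> proj S = proj S"
    using proj_in[OF S] proj_fixed_iff[OF S] by (intro blinfun_eqI) simp
  show "(proj S)\<^sup>\<dagger> = proj S"
  proof (rule hadj_eqI)
    fix x y
    have "inner (x - blinfun_apply (proj S) x) (blinfun_apply (proj S) y) = 0"
      "inner (y - blinfun_apply (proj S) y) (blinfun_apply (proj S) x) = 0"
      using proj_orth[OF S] proj_in[OF S] by auto
    then show "inner x (blinfun_apply (proj S) y) = inner (blinfun_apply (proj S) x) y"
      by (simp add: inner_simps inner_commute)
  qed
qed

text \<open>Invariance of \<open>S\<close> under the adjoint makes the orthogonal complement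
  invariant under \<open>T\<close>, so \<open>T\<close> respects the decomposition along
  \<open>S\<close>.\<close>

lemma proj_commute:
  fixes S :: "'a::{real_inner,banach} set"
  assumes S: "subspace S" "closed S"
    and inv: "\<And>x. x \<in> S \<Longrightarrow> blinfun_apply T x \<in> S" "\<And>x. x \<in> S \<Longrightarrow> blinfun_apply (T\<^sup>\<dagger>) x \<in> S"
  shows "proj S \<odot> T = T \<odot> proj S"
proof (rule blinfun_eqI)
  fix x
  have "blinfun_apply (proj S) (blinfun_apply T x) = blinfun_apply T (blinfun_apply (proj S) x)"
  proof (rule proj_eqI[OF S])
    show "blinfun_apply T (blinfun_apply (proj S) x) \<in> S" using inv proj_in[OF S] by blast
    fix z assume "z \<in> S"
    then have "inner (x - blinfun_apply (proj S) x) (blinfun_apply (T\<^sup>\<dagger>) z) = 0"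
      using inv proj_orth[OF S] by blast
    then show "inner (blinfun_apply T x - blinfun_apply T (blinfun_apply (proj S) x)) z = 0"
      by (simp add: hadj_right blinfun.bilinear_simps)
  qed
  then show "blinfun_apply (proj S \<odot> T) x = blinfun_apply (T \<odot> proj S) x" by simp
qed

section \<open>Calculation rules for composition\<close>

abbreviation op_apply :: "('a::real_normed_vector \<Rightarrow>\<^sub>L 'a) \<Rightarrow> 'a \<Rightarrow> 'a" (infixr \<open>\<cdot>\<close> 90)
  where "T \<cdot> x \<equiv> blinfun_apply T x"

lemmas comp_distribs =
  bounded_bilinear.add_left[OF bounded_bilinear_blinfun_compose]
  bounded_bilinear.add_right[OF bounded_bilinear_blinfun_compose]
  bounded_bilinear.diff_left[OF bounded_bilinear_blinfun_compose]
  bounded_bilinear.diff_right[OF bounded_bilinear_blinfun_compose]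
  bounded_bilinear.minus_left[OF bounded_bilinear_blinfun_compose]
  bounded_bilinear.minus_right[OF bounded_bilinear_blinfun_compose]
  bounded_bilinear.scaleR_left[OF bounded_bilinear_blinfun_compose]
  bounded_bilinear.scaleR_right[OF bounded_bilinear_blinfun_compose]

lemma comp_assoc: "(R \<odot> S) \<odot> T = R \<odot> (S \<odot> T)"
  by (rule blinfun_eqI) simp

lemma comp_id [simp]: "T \<odot> id_blinfun = T" "id_blinfun \<odot> T = T"
  by (rule blinfun_eqI, simp)+

lemmas comp_ring = comp_distribs comp_assoc

text \<open>With products bracketed to the right, a known product of two factors no longer occurs as
  a subterm; this form rewrites it at the head of a longer product.\<close>

lemma comp_reduce: "R \<odot> S = T \<Longrightarrow> R \<odot> (S \<odot> X) = T \<odot> X"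
  by (simp flip: comp_assoc)

subsection \<open>Orthogonal projections and ranges\<close>

definition projection :: "('a::{real_inner,banach} \<Rightarrow>\<^sub>L 'a) \<Rightarrow> bool"
  where "projection p \<longleftrightarrow> p \<odot> p = p \<and> p\<^sup>\<dagger> = p"

lemma projection_proj: "subspace S \<Longrightarrow> closed S \<Longrightarrow> projection (proj S)"
  by (simp add: projection_def proj_idem proj_hadj)

lemma projection_idem: "projection p \<Longrightarrow> p \<odot> p = p"
  and projection_hadj: "projection p \<Longrightarrow> p\<^sup>\<dagger> = p"
  by (auto simp: projection_def)

lemma projection_apply: "projection p \<Longrightarrow> p \<cdot> p \<cdot> x = p \<cdot> x"
  by (metis blinfun_apply_blinfun_compose projection_idem)

text \<open>The order of projections is expressed by \<open>p \<odot> q = p\<close>; taking adjoints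
  gives the mirrored equation.\<close>

lemma projection_comp_swap: "projection p \<Longrightarrow> projection q \<Longrightarrow> p \<odot> q = p \<Longrightarrow> q \<odot> p = p"
  by (metis hadj_comp projection_hadj)

text \<open>Each \<open>x\<close> differs from \<open>q \<cdot> x\<close> by a kernel vector of
  \<open>q\<close>. Comparisons of projections are reduced to their kernels in this way.\<close>

lemma comp_projection_eqI:
  assumes q: "projection q" and ker: "\<And>x. q \<cdot> x = 0 \<Longrightarrow> T \<cdot> x = 0"
  shows "T \<odot> q = T"
proof (rule blinfun_eqI)
  fix x
  have "q \<cdot> (x - q \<cdot> x) = 0" by (simp add: blinfun.bilinear_simps projection_apply[OF q])
  then have "T \<cdot> (x - q \<cdot> x) = 0" by (rule ker)
  then show "(T \<odot> q) \<cdot> x = T \<cdot> x" by (simp add: blinfun.bilinear_simps)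
qed

lemma projection_eq_kernelI:
  assumes p: "projection p" and q: "projection q" and ker: "\<And>x. p \<cdot> x = 0 \<longleftrightarrow> q \<cdot> x = 0"
  shows "p = q"
  using comp_projection_eqI[OF q, of p] comp_projection_eqI[OF p, of q] ker
    projection_comp_swap[OF p q] by auto

section \<open>Support projections of operators\<close>

lemma subspace_closure:
  fixes S :: "'a::real_normed_vector set"
  assumes "subspace S" shows "subspace (closure S)"
proof (rule subspaceI)
  show "0 \<in> closure S" using assms closure_subset subspace_0 by blast
next
  fix x y assume "x \<in> closure S" "y \<in> closure S"
  then obtain f g where "\<forall>n. f n \<in> S" "f \<longlonglongrightarrow> x" "\<forall>n. g n \<in> S" "g \<longlonglongrightarrow> y"
    unfolding closure_sequential by blast
  then show "x + y \<in> closure S"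
    unfolding closure_sequential using assms
    by (intro exI[of _ "\<lambda>n. f n + g n"]) (auto intro: tendsto_add subspace_add)
next
  fix c x assume "x \<in> closure S"
  then obtain f where "\<forall>n. f n \<in> S" "f \<longlonglongrightarrow> x"
    unfolding closure_sequential by blast
  then show "c *\<^sub>R x \<in> closure S"
    unfolding closure_sequential using assms
    by (intro exI[of _ "\<lambda>n. c *\<^sub>R f n"]) (auto intro: tendsto_scaleR subspace_scale)
qed

lemma subspace_range: "subspace (range (blinfun_apply T))"
  by (rule linear_subspace_image[OF bounded_linear.linear[OF blinfun.bounded_linear_right] subspace_UNIV])

text \<open>The left support of \<open>T\<close>. Applied to the adjoint it is the right support,
  the projection onto the orthogonal complement of the kernel of \<open>T\<close>.\<close>

definition range_proj_of :: "('a::{real_inner,banach} \<Rightarrow>\<^sub>L 'a) \<Rightarrow> ('a \<Rightarrow>\<^sub>L 'a)"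
  where "range_proj_of T = proj (closure (range (blinfun_apply T)))"

lemma subspace_closure_range: "subspace (closure (range (blinfun_apply T)))"
  by (rule subspace_closure[OF subspace_range])

lemma projection_range_proj_of: "projection (range_proj_of T)"
  unfolding range_proj_of_def by (rule projection_proj[OF subspace_closure_range closed_closure])

lemma range_range_proj_of: "range (blinfun_apply (range_proj_of T)) = closure (range (blinfun_apply T))"
  unfolding range_proj_of_def by (rule range_proj[OF subspace_closure_range closed_closure])

lemma range_proj_of_comp: "range_proj_of T \<odot> T = T"
  by (rule blinfun_eqI)
    (use closure_subset[of "range (blinfun_apply T)"] in \<open>auto simp: range_proj_of_def
      proj_fixed_iff[OF subspace_closure_range closed_closure]\<close>)

text \<open>The orthogonal complement of the range is the kernel of the adjoint. Together with the
  kernel criterion for equality this identifies support projections.\<close>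

lemma range_proj_of_eq_0_iff: "range_proj_of T \<cdot> x = 0 \<longleftrightarrow> T\<^sup>\<dagger> \<cdot> x = 0"
proof
  have *: "T\<^sup>\<dagger> = T\<^sup>\<dagger> \<odot> range_proj_of T"
    by (metis hadj_comp projection_hadj projection_range_proj_of range_proj_of_comp)
  assume "range_proj_of T \<cdot> x = 0"
  then show "T\<^sup>\<dagger> \<cdot> x = 0" by (subst *) simp
next
  assume x: "T\<^sup>\<dagger> \<cdot> x = 0"
  have "inner x y = 0" if "y \<in> closure (range (blinfun_apply T))" for y
  proof -
    have cl: "closed {y. inner x y = 0}" by (intro closed_Collect_eq continuous_intros)
    have "range (blinfun_apply T) \<subseteq> {y. inner x y = 0}"
      using x by (auto simp flip: hadj_left)
    from closure_minimal[OF this cl] that show ?thesis by auto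
  qed
  then show "range_proj_of T \<cdot> x = 0"
    unfolding range_proj_of_def
    by (intro proj_eqI[OF subspace_closure_range closed_closure])
      (auto simp: subspace_0[OF subspace_closure_range])
qed

lemma range_proj_of_eqI:
  assumes "projection p" "\<And>x. p \<cdot> x = 0 \<longleftrightarrow> T\<^sup>\<dagger> \<cdot> x = 0"
  shows "range_proj_of T = p"
  by (rule projection_eq_kernelI[OF projection_range_proj_of assms(1)])
    (simp add: assms range_proj_of_eq_0_iff)

lemma range_proj_of_projection: "projection p \<Longrightarrow> range_proj_of p = p"
  by (rule range_proj_of_eqI) (auto simp: projection_hadj)

text \<open>The left support is the least projection fixing \<open>T\<close> from the left: the
  adjoint of \<open>T\<close> vanishes wherever \<open>p\<close> does.\<close>

lemma range_proj_of_le: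
  assumes p: "projection p" and "p \<odot> T = T"
  shows "range_proj_of T \<odot> p = range_proj_of T"
proof (rule comp_projection_eqI[OF p])
  fix x assume x: "p \<cdot> x = 0"
  have "T\<^sup>\<dagger> \<odot> p = T\<^sup>\<dagger>" by (metis assms hadj_comp projection_hadj)
  then show "range_proj_of T \<cdot> x = 0"
    unfolding range_proj_of_eq_0_iff using x by (metis blinfun_apply_blinfun_compose blinfun.zero_right)
qed

text \<open>The range consists of the fixed points, so it is already closed and the left support of
  \<open>p\<close> projects onto it.\<close>

lemma projection_range: "projection p \<Longrightarrow> p = proj (range (blinfun_apply p))"
proof -
  assume p: "projection p"
  have "range (blinfun_apply p) = {x. p \<cdot> x = x}" by (auto simp: projection_apply[OF p]) (metis rangeI)
  moreover have "closed {x. p \<cdot> x = x}"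
    by (intro closed_Collect_eq continuous_intros)
  ultimately have "closed (range (blinfun_apply p))" by simp
  then show ?thesis using range_proj_of_projection[OF p] by (simp add: range_proj_of_def)
qed

subsection \<open>Square roots\<close>

text \<open>The scalar sequence \<open>t\<close> runs the same recursion with \<open>x = 1\<close> and dominates
  the increments of the operator sequence \<open>y\<close>, whose limit solves \<open>y = (x + y\<^sup>2) / 2\<close>.\<close>

lemma sqrt_of_id_minus_contraction:
  fixes x :: "'a::{real_inner,banach} \<Rightarrow>\<^sub>L 'a"
  assumes nx: "norm x \<le> 1" and sa: "x\<^sup>\<dagger> = x"
  shows "\<exists>R. R\<^sup>\<dagger> = R \<and> R \<odot> R = id_blinfun - x \<and> (\<forall>s. s \<odot> x = x \<odot> s \<longrightarrow> s \<odot> R = R \<odot> s)"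
proof -
  define y where "y = rec_nat (0::'a \<Rightarrow>\<^sub>L 'a) (\<lambda>_ y. (1/2) *\<^sub>R (x + y \<odot> y))"
  have y0: "y 0 = 0" and yS: "y (Suc n) = (1/2) *\<^sub>R (x + y n \<odot> y n)" for n
    by (simp_all add: y_def)
  define t where "t = rec_nat (0::real) (\<lambda>_ t. (1 + t * t) / 2)"
  have t0: "t 0 = 0" and tS: "t (Suc n) = (1 + t n * t n) / 2" for n
    by (simp_all add: t_def)
  have t1: "0 \<le> t n \<and> t n \<le> 1" for n
  proof (induction n)
    case (Suc n)
    then have "t n * t n \<le> 1 * 1" by (intro mult_mono) auto
    then show ?case using Suc by (simp add: tS)
  qed (simp add: t0)
  have tmono: "t n \<le> t (Suc n)" for n
  proof -
    have "0 \<le> (1 - t n) * (1 - t n)" by simp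
    then show ?thesis by (simp add: tS algebra_simps)
  qed
  have com: "s \<odot> y n = y n \<odot> s" if "s \<odot> x = x \<odot> s" for s n
  proof (induction n)
    case (Suc n)
    have "s \<odot> (y n \<odot> y n) = y n \<odot> y n \<odot> s" by (metis Suc comp_assoc)
    then show ?case using that by (simp add: yS comp_distribs)
  qed (simp add: y0)
  \<comment> \<open>\<open>com\<close> is used twice: with \<open>s = x\<close>, and then with
    \<open>s = y m\<close>.\<close>
  have ycom: "y m \<odot> y n = y n \<odot> y m" for m n
    by (rule com) (use com[of x m] in simp)
  have ysa: "(y n)\<^sup>\<dagger> = y n" for n by (induction n) (simp_all add: y0 yS sa)
  have ny: "norm (y n) \<le> t n" for n
  proof (induction n)
    case (Suc n)
    have "norm (y n \<odot> y n) \<le> norm (y n) * norm (y n)" by (rule norm_blinfun_compose)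
    also have "\<dots> \<le> t n * t n" using Suc t1 by (intro mult_mono) auto
    finally have "norm (x + y n \<odot> y n) \<le> 1 + t n * t n"
      using nx norm_triangle_ineq[of x "y n \<odot> y n"] by linarith
    then show ?case by (simp add: yS tS)
  qed (simp add: y0 t0)
  have step: "norm (y (Suc n) - y n) \<le> t (Suc n) - t n" for n
  proof (induction n)
    case 0 show ?case using ny[of 1] by (simp add: y0 t0)
  next
    case (Suc n)
    have "y (Suc (Suc n)) - y (Suc n) = (1/2) *\<^sub>R (y (Suc n) \<odot> y (Suc n) - y n \<odot> y n)"
      unfolding yS[of "Suc n"] yS[of n] by (simp add: algebra_simps)
    \<comment> \<open>The iterates commute, so the difference of squares factors and the two factors
      can be bounded through \<open>t\<close>.\<close>
    also have "y (Suc n) \<odot> y (Suc n) - y n \<odot> y n = (y (Suc n) - y n) \<odot> (y (Suc n) + y n)"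
      using ycom[of n "Suc n"] by (simp add: comp_distribs)
    finally have "norm (y (Suc (Suc n)) - y (Suc n)) = norm ((y (Suc n) - y n) \<odot> (y (Suc n) + y n)) / 2"
      by simp
    also have "\<dots> \<le> norm (y (Suc n) - y n) * norm (y (Suc n) + y n) / 2"
      by (intro divide_right_mono norm_blinfun_compose) simp
    also have "\<dots> \<le> (t (Suc n) - t n) * (t (Suc n) + t n) / 2"
      using ny[of n] ny[of "Suc n"] norm_triangle_ineq[of "y (Suc n)" "y n"] Suc tmono[of n]
      by (intro divide_right_mono mult_mono) auto
    also have "\<dots> = t (Suc (Suc n)) - t (Suc n)" unfolding tS[of "Suc n"] by (simp add: tS field_simps)
    finally show ?case .
  qed
  have diff: "norm (y (n + k) - y n) \<le> t (n + k) - t n" for n k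
  proof (induction k)
    case (Suc k)
    have "norm (y (n + Suc k) - y n) \<le> norm (y (Suc (n + k)) - y (n + k)) + norm (y (n + k) - y n)"
      using norm_triangle_ineq[of "y (Suc (n + k)) - y (n + k)" "y (n + k) - y n"] by simp
    then show ?case using Suc step[of "n + k"] by simp
  qed simp
  have "convergent t"
    by (rule Bseq_mono_convergent[OF BseqI'[of _ 1]])
      (use t1 tmono in \<open>auto simp: abs_le_iff intro: lift_Suc_mono_le\<close>)
  then have ct: "Cauchy t" by (rule convergent_Cauchy)
  have "Cauchy y"
  proof (rule CauchyI')
    fix e :: real assume "0 < e"
    with ct obtain N where N: "\<And>m n. m \<ge> N \<Longrightarrow> n \<ge> N \<Longrightarrow> norm (t m - t n) < e"
      using CauchyD by blast
    show "\<exists>N. \<forall>m\<ge>N. \<forall>n>m. dist (y m) (y n) < e"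
    proof (intro exI allI impI)
      fix m n assume mn: "N \<le> m" "m < n"
      have "norm (y m - y n) = norm (y (m + (n - m)) - y m)" using mn by (simp add: norm_minus_commute)
      also have "\<dots> \<le> t n - t m" using diff[of m "n - m"] mn by simp
      also have "\<dots> < e" using N[of n m] mn by (simp add: abs_less_iff)
      finally show "dist (y m) (y n) < e" by (simp add: dist_norm)
    qed
  qed
  then obtain l where l: "y \<longlonglongrightarrow> l" using Cauchy_convergent convergent_def by blast
  have comp_lim: "(\<lambda>n. f n \<odot> g n) \<longlonglongrightarrow> a \<odot> b" if "f \<longlonglongrightarrow> a" "g \<longlonglongrightarrow> b" for f g :: "nat \<Rightarrow> 'a \<Rightarrow>\<^sub>L 'a" and a b
    by (rule bounded_bilinear.tendsto[OF bounded_bilinear_blinfun_compose that])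
  have "(\<lambda>n. y (Suc n)) \<longlonglongrightarrow> (1/2) *\<^sub>R (x + l \<odot> l)"
    unfolding yS by (intro tendsto_intros comp_lim l)
  then have eq: "l = (1/2) *\<^sub>R (x + l \<odot> l)" using LIMSEQ_unique LIMSEQ_Suc[OF l] by blast
  from arg_cong[OF this, of "\<lambda>z. 2 *\<^sub>R z"] have eq2: "x + l \<odot> l = l + l"
    by (simp add: scaleR_2)
  have lsa: "l\<^sup>\<dagger> = l"
  proof (rule hadj_eqI)
    fix u v
    have "(\<lambda>n. inner u (y n \<cdot> v)) \<longlonglongrightarrow> inner u (l \<cdot> v)"
      by (intro tendsto_intros l)
    moreover have "(\<lambda>n. inner u (y n \<cdot> v)) \<longlonglongrightarrow> inner (l \<cdot> u) v"
      by (subst ysa[symmetric], subst hadj_right) (intro tendsto_intros l)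
    ultimately show "inner u (l \<cdot> v) = inner (l \<cdot> u) v" by (rule LIMSEQ_unique)
  qed
  have lcom: "s \<odot> l = l \<odot> s" if "s \<odot> x = x \<odot> s" for s
  proof (rule LIMSEQ_unique)
    show "(\<lambda>n. s \<odot> y n) \<longlonglongrightarrow> s \<odot> l" by (intro comp_lim l tendsto_intros)
    show "(\<lambda>n. s \<odot> y n) \<longlonglongrightarrow> l \<odot> s" unfolding com[OF that] by (intro comp_lim l tendsto_intros)
  qed
  show ?thesis
  proof (intro exI[of _ "id_blinfun - l"] conjI allI impI)
    show "(id_blinfun - l)\<^sup>\<dagger> = id_blinfun - l" by (simp add: lsa)
    have "(id_blinfun - l) \<odot> (id_blinfun - l) = id_blinfun - (l + l) + l \<odot> l"
      by (simp add: comp_distribs)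
    then show "(id_blinfun - l) \<odot> (id_blinfun - l) = id_blinfun - x"
      by (simp add: eq2[symmetric])
    show "s \<odot> (id_blinfun - l) = (id_blinfun - l) \<odot> s" if "s \<odot> x = x \<odot> s" for s
      using lcom[OF that] by (simp add: comp_distribs)
  qed
qed

section \<open>Partial isometries\<close>

lemma hadj_comp_self_eq_0:
  assumes "T\<^sup>\<dagger> \<odot> T = 0" shows "T = 0"
proof (rule blinfun_eqI)
  fix x
  have "inner (T \<cdot> x) (T \<cdot> x) = inner x ((T\<^sup>\<dagger> \<odot> T) \<cdot> x)" by (simp add: hadj_right)
  then show "T \<cdot> x = 0 \<cdot> x" using assms by simp
qed

text \<open>The defect \<open>D = v \<odot> q - v\<close> satisfies
  \<open>D\<^sup>\<dagger> \<odot> D = 0\<close>, hence vanishes.\<close>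

lemma partial_isometry_right:
  assumes "v\<^sup>\<dagger> \<odot> v = q" "projection q" shows "v \<odot> q = v" "q \<odot> v\<^sup>\<dagger> = v\<^sup>\<dagger>"
proof -
  note [simp] = assms(1) comp_reduce[OF assms(1)] projection_idem[OF assms(2)] projection_hadj[OF assms(2)]
  have "(v \<odot> q - v)\<^sup>\<dagger> \<odot> (v \<odot> q - v) = 0" by (simp add: comp_ring)
  from hadj_comp_self_eq_0[OF this] show 1: "v \<odot> q = v" by simp
  have "(v \<odot> q)\<^sup>\<dagger> = v\<^sup>\<dagger>" by (simp only: 1)
  then show "q \<odot> v\<^sup>\<dagger> = v\<^sup>\<dagger>" by simp
qed

lemma partial_isometry_left:
  assumes "v \<odot> v\<^sup>\<dagger> = p" "projection p" shows "p \<odot> v = v" "v\<^sup>\<dagger> \<odot> p = v\<^sup>\<dagger>"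
  using partial_isometry_right[of "v\<^sup>\<dagger>" p] assms by auto

subsection \<open>Von Neumann algebras and polar decomposition\<close>

text \<open>Recovers the imaginary part from the real inner product, so that identities for
  \<open>cinner\<close> can be checked on \<open>inner\<close>.\<close>

lemma Im_cinner: "Im (cinner x y) = inner x (\<i> *\<^sub>C y)"
proof -
  have "inner x (\<i> *\<^sub>C y) = Re (cinner x (\<i> *\<^sub>C y))" by (simp add: Re_cinner)
  also have "cinner x (\<i> *\<^sub>C y) = cnj (\<i> * cinner y x)"
    using cinner_commute[of x "\<i> *\<^sub>C y"] by (simp add: cinner_scaleC_left)
  also have "\<dots> = - \<i> * cinner x y" by (subst cinner_commute[of x]) simp
  finally show ?thesis by simp
qed

lemma inner_scaleC_left: "inner (c *\<^sub>C x) y = inner x (cnj c *\<^sub>C (y :: 'h::complex_hilbert))"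
proof -
  have "cinner x (cnj c *\<^sub>C y) = cnj (cnj c * cinner y x)"
    using cinner_commute[of x "cnj c *\<^sub>C y"] by (simp add: cinner_scaleC_left)
  also have "\<dots> = cinner (c *\<^sub>C x) y"
    by (subst cinner_commute[of y]) (simp add: cinner_scaleC_left)
  finally show ?thesis by (simp flip: Re_cinner)
qed

text \<open>Complex linearity lets \<open>\<i>\<close> pass through \<open>T\<close>, so the real
  adjoint identity also settles the imaginary parts. Conversely, the real parts alone determine the
  operator.\<close>

lemma adj_eq_hadj:
  fixes T :: "'h::complex_hilbert \<Rightarrow>\<^sub>L 'h"
  assumes "T \<in> bounded_ops"
  shows "adj T = T\<^sup>\<dagger>"
  unfolding adj_def
proof (rule the_equality)
  show "\<forall>x y. cinner (T\<^sup>\<dagger> \<cdot> x) y = cinner x (T \<cdot> y)"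
    using assms by (auto simp: complex_eq_iff Re_cinner Im_cinner hadj_left bounded_ops_def)
next
  fix S :: "'h \<Rightarrow>\<^sub>L 'h" assume *: "\<forall>x y. cinner (S \<cdot> x) y = cinner x (T \<cdot> y)"
  have "T\<^sup>\<dagger> = S" by (rule hadj_eqI) (metis * Re_cinner inner_commute)
  then show "S = T\<^sup>\<dagger>" ..
qed

lemma scaleC_operator:
  obtains J :: "'h::complex_hilbert \<Rightarrow>\<^sub>L 'h" where "\<And>x. J \<cdot> x = c *\<^sub>C x"
proof -
  have "bounded_linear (\<lambda>x::'h. c *\<^sub>C x)"
  proof (rule bounded_linear_intro[of _ "cmod c"])
    fix r and x :: 'h
    show "c *\<^sub>C r *\<^sub>R x = r *\<^sub>R c *\<^sub>C x"
      by (simp add: scaleC_scaleC mult.commute flip: scaleC_of_real)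
  next
    fix x :: 'h
    have "(norm (c *\<^sub>C x))\<^sup>2 = inner x ((cnj c * c) *\<^sub>C x)"
      by (simp add: power2_norm_eq_inner inner_scaleC_left scaleC_scaleC)
    also have "cnj c * c = complex_of_real ((cmod c)\<^sup>2)"
      using complex_norm_square[of c] by (simp add: mult.commute)
    finally have "(norm (c *\<^sub>C x))\<^sup>2 = (norm x * cmod c)\<^sup>2"
      by (simp only: scaleC_of_real) (simp add: power2_norm_eq_inner power_mult_distrib mult.commute)
    then show "norm (c *\<^sub>C x) \<le> norm x * cmod c" by (simp add: power2_eq_iff_nonneg)
  qed (rule scaleC_add_right)
  then show ?thesis using that[of "Blinfun (\<lambda>x. c *\<^sub>C x)"] by (simp add: bounded_linear_Blinfun_apply)
qed

section \<open>Membership in a von Neumann algebra through its commutant\<close>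

locale vn_algebra =
  fixes A :: "('h::complex_hilbert \<Rightarrow>\<^sub>L 'h) set"
  assumes vna: "von_neumann_algebra A"
begin

lemma adj_A: "T \<in> A \<Longrightarrow> adj T = T\<^sup>\<dagger>"
  using vna adj_eq_hadj unfolding von_neumann_algebra_def by blast

lemma hadj_A: "T \<in> A \<Longrightarrow> T\<^sup>\<dagger> \<in> A"
  using vna adj_A unfolding von_neumann_algebra_def by metis

lemma hadj_commutant: "s \<in> commutant A \<Longrightarrow> s\<^sup>\<dagger> \<in> commutant A"
proof -
  assume s: "s \<in> commutant A"
  have "s\<^sup>\<dagger> \<cdot> (c *\<^sub>C x) = c *\<^sub>C (s\<^sup>\<dagger> \<cdot> x)" for c x
  proof (rule inner_eqI)
    fix y
    have "inner y (s\<^sup>\<dagger> \<cdot> (c *\<^sub>C x)) = inner (cnj c *\<^sub>C (s \<cdot> y)) x"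
      by (simp add: hadj_right inner_scaleC_left)
    also have "cnj c *\<^sub>C (s \<cdot> y) = s \<cdot> (cnj c *\<^sub>C y)" using s by (simp add: commutant_def bounded_ops_def)
    finally show "inner y (s\<^sup>\<dagger> \<cdot> (c *\<^sub>C x)) = inner y (c *\<^sub>C (s\<^sup>\<dagger> \<cdot> x))"
      by (simp add: inner_scaleC_left flip: hadj_right)
  qed
  moreover have "s\<^sup>\<dagger> \<odot> T = T \<odot> s\<^sup>\<dagger>" if "T \<in> A" for T
  proof -
    have "s \<odot> T\<^sup>\<dagger> = T\<^sup>\<dagger> \<odot> s" using s hadj_A[OF that] by (simp add: commutant_def)
    then have "(s \<odot> T\<^sup>\<dagger>)\<^sup>\<dagger> = (T\<^sup>\<dagger> \<odot> s)\<^sup>\<dagger>" by simp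
    then show ?thesis by simp
  qed
  ultimately show ?thesis by (simp add: commutant_def bounded_ops_def)
qed

text \<open>Complex linearity comes for free: multiplication by a scalar lies in the commutant.\<close>

lemma A_iff: "T \<in> A \<longleftrightarrow> (\<forall>s\<in>commutant A. T \<odot> s = s \<odot> T)"
proof
  assume "T \<in> A" then show "\<forall>s\<in>commutant A. T \<odot> s = s \<odot> T" by (auto simp: commutant_def)
next
  assume *: "\<forall>s\<in>commutant A. T \<odot> s = s \<odot> T"
  have "T \<cdot> (c *\<^sub>C x) = c *\<^sub>C (T \<cdot> x)" for c x
  proof -
    obtain J :: "'h \<Rightarrow>\<^sub>L 'h" where J: "\<And>x. J \<cdot> x = c *\<^sub>C x" using scaleC_operator by blast
    have "A \<subseteq> bounded_ops" using vna by (simp add: von_neumann_algebra_def)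
    then have "J \<in> commutant A"
      by (auto simp: commutant_def bounded_ops_def J scaleC_scaleC mult.commute intro!: blinfun_eqI)
    then have "(T \<odot> J) \<cdot> x = (J \<odot> T) \<cdot> x" using * by simp
    then show ?thesis by (simp add: J)
  qed
  then have "T \<in> commutant (commutant A)" using * by (simp add: commutant_def[of "commutant A"] bounded_ops_def)
  then show "T \<in> A" using vna by (simp add: von_neumann_algebra_def)
qed

lemma A_commute: "T \<in> A \<Longrightarrow> s \<in> commutant A \<Longrightarrow> T \<odot> s = s \<odot> T"
  by (auto simp: commutant_def)

lemma A_commute_apply: "T \<in> A \<Longrightarrow> s \<in> commutant A \<Longrightarrow> T \<cdot> s \<cdot> x = s \<cdot> T \<cdot> x"
  by (metis A_commute blinfun_apply_blinfun_compose)

lemma A_closed [intro]: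
  "S \<in> A \<Longrightarrow> T \<in> A \<Longrightarrow> S + T \<in> A" "S \<in> A \<Longrightarrow> T \<in> A \<Longrightarrow> S - T \<in> A"
  "S \<in> A \<Longrightarrow> T \<in> A \<Longrightarrow> S \<odot> T \<in> A" "S \<in> A \<Longrightarrow> r *\<^sub>R S \<in> A" "S \<in> A \<Longrightarrow> - S \<in> A"
  "S \<in> A \<Longrightarrow> S\<^sup>\<dagger> \<in> A" "id_blinfun \<in> A" "0 \<in> A"
  using hadj_A by (auto simp: A_iff comp_distribs) (metis comp_assoc)

lemma Proj_iff: "p \<in> Proj A \<longleftrightarrow> p \<in> A \<and> projection p"
  unfolding Proj_def projection_def using adj_A by auto

lemma mvn_equiv_iff: "mvn_equiv A p q \<longleftrightarrow> (\<exists>v\<in>A. v \<odot> v\<^sup>\<dagger> = p \<and> v\<^sup>\<dagger> \<odot> v = q)"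
  unfolding mvn_equiv_def using adj_A by auto

text \<open>The commutant is closed under adjoints, so invariance of \<open>S\<close> makes
  \<open>proj S\<close> commute with it, and the bicommutant condition puts \<open>proj S\<close>
  into \<open>A\<close>.\<close>

lemma proj_in_Proj:
  assumes S: "subspace S" "closed S" and inv: "\<And>s x. s \<in> commutant A \<Longrightarrow> x \<in> S \<Longrightarrow> s \<cdot> x \<in> S"
  shows "proj S \<in> Proj A"
  unfolding Proj_iff A_iff using projection_proj[OF S] proj_commute[OF S inv inv] hadj_commutant
  by blast

lemma closure_invariant:
  assumes "\<And>x. x \<in> S \<Longrightarrow> s \<cdot> x \<in> S" "x \<in> closure S"
  shows "s \<cdot> x \<in> closure S"
proof -
  have "blinfun_apply s ` closure S \<subseteq> closure (blinfun_apply s ` S)"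
    by (rule image_closure_subset) (auto intro: continuous_intros closure_subset[THEN subsetD] closed_closure
        linear_continuous_on blinfun.bounded_linear_right)
  also have "\<dots> \<subseteq> closure S" using assms(1) by (intro closure_mono) auto
  finally show ?thesis using assms(2) by blast
qed

lemma range_proj_of_in_Proj: "T \<in> A \<Longrightarrow> range_proj_of T \<in> Proj A"
  unfolding range_proj_of_def
proof (rule proj_in_Proj[OF subspace_closure_range closed_closure])
  fix s x assume "T \<in> A" "s \<in> commutant A" and x: "x \<in> closure (range (blinfun_apply T))"
  then have "s \<cdot> T \<cdot> z = T \<cdot> s \<cdot> z" for z by (metis A_commute_apply)
  then have "s \<cdot> y \<in> range (blinfun_apply T)" if "y \<in> range (blinfun_apply T)" for y
    using that by auto
  then show "s \<cdot> x \<in> closure (range (blinfun_apply T))" using x by (rule closure_invariant)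
qed

text \<open>A subspace of pairs of equal norm is the graph of an isometry. The isometry extends to
  the closures by continuity and by zero to the orthogonal complement; invariance of the graph under
  the commutant places the extension in \<open>A\<close>.\<close>

lemma partial_isometry_of_graph:
  fixes K :: "('h \<times> 'h) set"
  assumes K: "subspace K" and iso: "\<And>x y. (x, y) \<in> K \<Longrightarrow> norm x = norm y"
    and inv: "\<And>s x y. s \<in> commutant A \<Longrightarrow> (x, y) \<in> K \<Longrightarrow> (s \<cdot> x, s \<cdot> y) \<in> K"
  obtains v where "v \<in> A" "v\<^sup>\<dagger> \<odot> v = proj (closure (fst ` K))" "v \<odot> v\<^sup>\<dagger> = proj (closure (snd ` K))"
proof -
  define C where "C = closure K"
  have C: "subspace C" "closed C" unfolding C_def using subspace_closure[OF K] by auto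
  have KC: "K \<subseteq> C" unfolding C_def by (rule closure_subset)
  have isoC: "norm x = norm y" if "(x, y) \<in> C" for x y
  proof -
    have "closed {z::'h \<times> 'h. norm (fst z) = norm (snd z)}"
      by (intro closed_Collect_eq continuous_intros)
    moreover have "K \<subseteq> {z. norm (fst z) = norm (snd z)}" using iso by auto
    ultimately have "C \<subseteq> {z. norm (fst z) = norm (snd z)}" unfolding C_def by (rule closure_minimal[rotated])
    then show ?thesis using that by auto
  qed
  have invC: "(s \<cdot> x, s \<cdot> y) \<in> C" if s: "s \<in> commutant A" and xy: "(x, y) \<in> C" for s x y
  proof -
    obtain f where f: "\<And>n. f n \<in> K" "f \<longlonglongrightarrow> (x, y)"
      using xy unfolding C_def closure_sequential by blast
    have "(\<lambda>n. (s \<cdot> fst (f n), s \<cdot> snd (f n))) \<longlonglongrightarrow> (s \<cdot> x, s \<cdot> y)"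
      using tendsto_fst[OF f(2)] tendsto_snd[OF f(2)] by (auto intro!: tendsto_intros)
    moreover have "(s \<cdot> fst (f n), s \<cdot> snd (f n)) \<in> K" for n using inv[OF s] f(1) by (metis prod.collapse)
    ultimately show ?thesis unfolding C_def closure_sequential
      by (intro exI[of _ "\<lambda>n. (s \<cdot> fst (f n), s \<cdot> snd (f n))"]) simp
  qed
  \<comment> \<open>On \<open>C\<close> a pair is bounded by twice the norm of either coordinate, so
    a convergent sequence of coordinates lifts to a convergent sequence of pairs.\<close>
  have closed_img: "closed (h ` C)" if h: "h = fst \<or> h = snd" for h :: "'h \<times> 'h \<Rightarrow> 'h"
    unfolding closed_sequential_limits
  proof (intro allI impI, elim conjE)
    fix u l assume u: "\<forall>n. u n \<in> h ` C" and ul: "u \<longlonglongrightarrow> l"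
    from u have "\<forall>n. \<exists>z. z \<in> C \<and> u n = h z" by blast
    then obtain w where w: "\<And>n. w n \<in> C" "\<And>n. u n = h (w n)" by metis
    have d: "norm (z - z') \<le> 2 * norm (h z - h z')" if "z \<in> C" "z' \<in> C" for z z'
    proof -
      have "z - z' \<in> C" using that C(1) by (rule subspace_diff[rotated])
      then have "norm (fst (z - z')) = norm (snd (z - z'))" using isoC by (metis prod.collapse)
      moreover have "norm (z - z') \<le> norm (fst (z - z')) + norm (snd (z - z'))"
        by (metis norm_Pair_le prod.collapse)
      ultimately show ?thesis using h by auto
    qed
    have "Cauchy u" using ul by (simp add: LIMSEQ_imp_Cauchy)
    have "Cauchy w"
    proof (rule CauchyI)
      fix e :: real assume "0 < e"
      then obtain N where N: "\<forall>m\<ge>N. \<forall>n\<ge>N. norm (u m - u n) < e / 2"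
        using CauchyD[OF \<open>Cauchy u\<close>, of "e / 2"] by auto
      have "norm (w m - w n) < e" if "m \<ge> N" "n \<ge> N" for m n
      proof -
        have "norm (u m - u n) < e / 2" using N that by blast
        then show ?thesis using d[OF w(1) w(1), of m n] unfolding w(2) by linarith
      qed
      then show "\<exists>N. \<forall>m\<ge>N. \<forall>n\<ge>N. norm (w m - w n) < e" by blast
    qed
    then obtain w0 where w0: "w \<longlonglongrightarrow> w0" using Cauchy_convergent convergent_def by blast
    then have "w0 \<in> C" using C(2) w(1) closed_sequentially by blast
    moreover have "u \<longlonglongrightarrow> h w0" unfolding w(2)[abs_def] using w0 h by (auto intro: tendsto_intros)
    ultimately show "l \<in> h ` C" using ul LIMSEQ_unique by blast
  qed
  have closure_img: "closure (h ` K) = h ` C" if h: "h = fst \<or> h = snd" for h :: "'h \<times> 'h \<Rightarrow> 'h"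
  proof
    show "closure (h ` K) \<subseteq> h ` C" using KC closed_img[OF h] by (intro closure_minimal) auto
    have "continuous_on C h" using h by (auto intro: continuous_intros)
    then show "h ` C \<subseteq> closure (h ` K)"
      unfolding C_def by (intro image_closure_subset) (auto intro: closure_subset[THEN subsetD])
  qed
  have linfst: "linear (fst :: 'h \<times> 'h \<Rightarrow> 'h)" by (simp add: bounded_linear.linear bounded_linear_fst)
  have linsnd: "linear (snd :: 'h \<times> 'h \<Rightarrow> 'h)" by (simp add: bounded_linear.linear bounded_linear_snd)
  define D where "D = fst ` C"
  have D: "subspace D" "closed D"
    unfolding D_def using linear_subspace_image[OF linfst C(1)] closed_img by auto
  define R where "R = snd ` C"
  have R: "subspace R" "closed R"
    unfolding R_def using linear_subspace_image[OF linsnd C(1)] closed_img by auto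
  define p where "p = proj D"
  have p: "projection p" unfolding p_def by (rule projection_proj[OF D])
  have uniq: "y = y'" if "(x, y) \<in> C" "(x, y') \<in> C" for x y y'
  proof -
    have "(x, y) - (x, y') \<in> C" using that C(1) by (intro subspace_diff)
    then show ?thesis using isoC by fastforce
  qed
  \<comment> \<open>Composing with \<open>p\<close> extends the isometry by zero off its domain
    \<open>D\<close>.\<close>
  have "\<exists>y. (p \<cdot> x, y) \<in> C" for x
    using proj_in[OF D, of x] unfolding p_def D_def by force
  then obtain g where g: "\<And>x. (p \<cdot> x, g x) \<in> C" by metis
  have "bounded_linear g"
  proof (rule bounded_linear_intro[of _ "norm p"])
    fix x y
    have "(p \<cdot> x, g x) + (p \<cdot> y, g y) \<in> C" using g C(1) by (intro subspace_add)
    then show "g (x + y) = g x + g y"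
      by (intro uniq[OF g]) (simp add: blinfun.bilinear_simps)
  next
    fix r x
    have "r *\<^sub>R (p \<cdot> x, g x) \<in> C" using g C(1) by (intro subspace_scale)
    then show "g (r *\<^sub>R x) = r *\<^sub>R g x"
      by (intro uniq[OF g]) (simp add: blinfun.bilinear_simps)
  next
    fix x show "norm (g x) \<le> norm x * norm p"
      using isoC[OF g[of x]] norm_blinfun[of p x] by (simp add: mult.commute)
  qed
  then obtain v where v: "\<And>x. v \<cdot> x = g x" using bounded_linear_Blinfun_apply by metis
  have vC: "v \<cdot> x = y" if "(x, y) \<in> C" for x y
  proof -
    have "x \<in> D" unfolding D_def using that by (metis fst_conv imageI)
    then have "p \<cdot> x = x" unfolding p_def using proj_fixed_iff[OF D] by blast
    then show ?thesis using uniq[OF g[of x]] that v by simp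
  qed
  have gC: "(p \<cdot> x, v \<cdot> x) \<in> C" for x using g v by simp
  have pcom: "p \<in> A"
  proof -
    have "s \<cdot> x \<in> D" if "s \<in> commutant A" "x \<in> D" for s x
      using that invC unfolding D_def by force
    then show ?thesis unfolding p_def using proj_in_Proj[OF D] Proj_iff by blast
  qed
  \<comment> \<open>Both \<open>s \<cdot> v \<cdot> x\<close> and
    \<open>v \<cdot> s \<cdot> x\<close> are partners of \<open>p \<cdot> s \<cdot> x\<close> in
    \<open>C\<close>, and partners are unique.\<close>
  have vA: "v \<in> A"
    unfolding A_iff
  proof (intro ballI blinfun_eqI)
    fix s x assume s: "s \<in> commutant A"
    have "(p \<cdot> s \<cdot> x, s \<cdot> v \<cdot> x) \<in> C"
      using invC[OF s gC[of x]] A_commute_apply[OF pcom s] by simp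
    with gC[of "s \<cdot> x"] uniq show "(v \<odot> s) \<cdot> x = (s \<odot> v) \<cdot> x" by auto
  qed
  have nv: "norm (v \<cdot> x) = norm (p \<cdot> x)" for x using isoC[OF gC[of x]] by simp
  \<comment> \<open>Polarization of the equality of norms \<open>nv\<close>.\<close>
  have polar: "inner (v \<cdot> x) (v \<cdot> y) = inner (p \<cdot> x) (p \<cdot> y)" for x y
  proof -
    have "(norm (v \<cdot> (x + y)))\<^sup>2 = (norm (p \<cdot> (x + y)))\<^sup>2" by (simp add: nv)
    moreover have "(norm (v \<cdot> x))\<^sup>2 = (norm (p \<cdot> x))\<^sup>2" "(norm (v \<cdot> y))\<^sup>2 = (norm (p \<cdot> y))\<^sup>2" by (simp_all add: nv)
    ultimately show ?thesis
      unfolding power2_norm_eq_inner by (simp add: blinfun.bilinear_simps inner_simps inner_commute)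
  qed
  have vv: "v\<^sup>\<dagger> \<odot> v = p"
  proof (rule blinfun_eqI, rule inner_eqI)
    fix x y show "inner y ((v\<^sup>\<dagger> \<odot> v) \<cdot> x) = inner y (p \<cdot> x)"
      using polar[of y x] p by (simp add: hadj_right) (metis hadj_right projection_apply projection_hadj)
  qed
  have vp: "v \<odot> p = v"
    by (rule comp_projection_eqI[OF p]) (metis norm_eq_zero nv)
  have pr: "projection (v \<odot> v\<^sup>\<dagger>)"
    unfolding projection_def by (simp add: comp_assoc comp_reduce[OF vv]) (simp add: vp flip: comp_assoc)
  have "range (blinfun_apply (v \<odot> v\<^sup>\<dagger>)) = R"
  proof
    show "range (blinfun_apply (v \<odot> v\<^sup>\<dagger>)) \<subseteq> R"
      unfolding R_def using gC by (force simp: image_iff)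
    show "R \<subseteq> range (blinfun_apply (v \<odot> v\<^sup>\<dagger>))"
    proof
      fix y assume "y \<in> R"
      then obtain x where "(x, y) \<in> C" unfolding R_def by auto
      then have "y = v \<cdot> x" using vC by simp
      also have "\<dots> = (v \<odot> v\<^sup>\<dagger>) \<cdot> v \<cdot> x"
        using vp vv by (metis blinfun_apply_blinfun_compose comp_assoc)
      finally show "y \<in> range (blinfun_apply (v \<odot> v\<^sup>\<dagger>))" by blast
    qed
  qed
  then have "v \<odot> v\<^sup>\<dagger> = proj R" using projection_range[OF pr] by simp
  then show ?thesis
    using that[OF vA] vv closure_img unfolding p_def D_def R_def by auto
qed

text \<open>Polar decomposition. With \<open>R\<close> the absolute value of a rescaled
  \<open>T\<close>, the map from \<open>R \<cdot> z\<close> to \<open>S \<cdot> z\<close> is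
  isometric, and its partial isometry links the left supports of \<open>R\<close> and
  \<open>S\<close>. As \<open>R\<close> is selfadjoint with the kernel of \<open>T\<close>, its
  support is the right support of \<open>T\<close>.\<close>

lemma range_proj_of_equiv:
  assumes T: "T \<in> A"
  shows "mvn_equiv A (range_proj_of T) (range_proj_of (T\<^sup>\<dagger>))"
proof -
  \<comment> \<open>The added \<open>1\<close> makes the scaling a contraction also for
    \<open>T = 0\<close>; rescaling changes no support.\<close>
  define S where "S = (1 / (norm T + 1)) *\<^sub>R T"
  have SA: "S \<in> A" unfolding S_def using T by auto
  have S1: "norm S \<le> 1" by (simp add: S_def divide_le_eq_1 add_nonneg_pos)
  have pos: "norm T + 1 \<noteq> 0" by (metis add_nonneg_pos less_irrefl norm_ge_zero zero_less_one)
  then have S0: "S \<cdot> x = 0 \<longleftrightarrow> T \<cdot> x = 0" for x by (simp add: S_def blinfun.bilinear_simps)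
  \<comment> \<open>Chosen so that \<open>id_blinfun - x\<close> is
    \<open>S\<^sup>\<dagger> \<odot> S\<close>, whose square root is wanted.\<close>
  define x where "x = id_blinfun - S\<^sup>\<dagger> \<odot> S"
  have "norm x \<le> 1"
  proof (rule norm_blinfun_bound)
    fix h
    have n: "norm (U \<cdot> z) \<le> norm z" if "norm U \<le> 1" for U :: "'h \<Rightarrow>\<^sub>L 'h" and z
      using norm_blinfun[of U z] mult_right_mono[OF that, of "norm z"] by simp
    have "(norm (x \<cdot> h))\<^sup>2 = (norm h)\<^sup>2 - 2 * (norm (S \<cdot> h))\<^sup>2 + (norm (S\<^sup>\<dagger> \<cdot> S \<cdot> h))\<^sup>2"
      unfolding x_def power2_norm_eq_inner
      by (simp add: blinfun.bilinear_simps inner_simps hadj_right hadj_left inner_commute)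
    also have "\<dots> \<le> (norm h)\<^sup>2"
    proof -
      have "(norm (S\<^sup>\<dagger> \<cdot> S \<cdot> h))\<^sup>2 \<le> (norm (S \<cdot> h))\<^sup>2"
        using S1 by (intro power_mono n) auto
      then show ?thesis using zero_le_power2[of "norm (S \<cdot> h)"] by linarith
    qed
    finally show "norm (x \<cdot> h) \<le> 1 * norm h" by (simp add: power2_le_iff_abs_le)
  qed simp
  moreover have "x\<^sup>\<dagger> = x" by (simp add: x_def)
  ultimately obtain R where R: "R\<^sup>\<dagger> = R" "R \<odot> R = id_blinfun - x"
    and Rcom: "\<And>s. s \<odot> x = x \<odot> s \<Longrightarrow> s \<odot> R = R \<odot> s"
    using sqrt_of_id_minus_contraction by blast
  have xA: "x \<in> A" unfolding x_def using SA by auto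
  \<comment> \<open>The root commutes with everything that commutes with \<open>x\<close>, in
    particular with the commutant of \<open>A\<close>.\<close>
  have RA: "R \<in> A" unfolding A_iff using Rcom A_commute[OF xA] by metis
  have nRS: "norm (R \<cdot> z) = norm (S \<cdot> z)" for z
  proof -
    have "(norm (R \<cdot> z))\<^sup>2 = inner z ((R \<odot> R) \<cdot> z)"
      using hadj_right[of z R "R \<cdot> z"] R(1) by (simp add: power2_norm_eq_inner)
    also have "\<dots> = (norm (S \<cdot> z))\<^sup>2" unfolding R(2) x_def by (simp add: power2_norm_eq_inner hadj_right)
    finally show ?thesis by simp
  qed
  define K where "K = range (\<lambda>z. (R \<cdot> z, S \<cdot> z))"
  have "subspace K"
    unfolding K_def subspace_def
  proof (intro conjI ballI allI)
    show "0 \<in> range (\<lambda>z. (R \<cdot> z, S \<cdot> z))"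
      by (rule range_eqI[of _ _ 0]) (simp add: zero_prod_def)
  next
    fix u w assume "u \<in> range (\<lambda>z. (R \<cdot> z, S \<cdot> z))" "w \<in> range (\<lambda>z. (R \<cdot> z, S \<cdot> z))"
    then obtain a b where "u = (R \<cdot> a, S \<cdot> a)" "w = (R \<cdot> b, S \<cdot> b)" by auto
    then show "u + w \<in> range (\<lambda>z. (R \<cdot> z, S \<cdot> z))"
      by (intro range_eqI[of _ _ "a + b"]) (simp add: blinfun.bilinear_simps)
  next
    fix r u assume "u \<in> range (\<lambda>z. (R \<cdot> z, S \<cdot> z))"
    then obtain a where "u = (R \<cdot> a, S \<cdot> a)" by auto
    then show "r *\<^sub>R u \<in> range (\<lambda>z. (R \<cdot> z, S \<cdot> z))"
      by (intro range_eqI[of _ _ "r *\<^sub>R a"]) (simp add: blinfun.bilinear_simps)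
  qed
  then obtain v where v: "v \<in> A" "v\<^sup>\<dagger> \<odot> v = proj (closure (fst ` K))" "v \<odot> v\<^sup>\<dagger> = proj (closure (snd ` K))"
  proof (rule partial_isometry_of_graph)
    fix x y assume "(x, y) \<in> K" then show "norm x = norm y" using nRS by (auto simp: K_def)
  next
    fix s x y assume s: "s \<in> commutant A" "(x, y) \<in> K"
    then obtain z where "x = R \<cdot> z" "y = S \<cdot> z" by (auto simp: K_def)
    then show "(s \<cdot> x, s \<cdot> y) \<in> K"
      unfolding K_def using A_commute_apply[OF RA s(1), of z] A_commute_apply[OF SA s(1), of z]
      by (intro range_eqI[of _ _ "s \<cdot> z"]) simp
  qed
  have "fst ` K = range (blinfun_apply R)" "snd ` K = range (blinfun_apply S)"
    by (auto simp: K_def image_image)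
  then have vR: "v\<^sup>\<dagger> \<odot> v = range_proj_of R" and vS: "v \<odot> v\<^sup>\<dagger> = range_proj_of S"
    using v by (simp_all add: range_proj_of_def)
  have "range_proj_of R = range_proj_of (T\<^sup>\<dagger>)"
    by (rule range_proj_of_eqI[OF projection_range_proj_of])
      (metis R(1) S0 hadj_hadj nRS norm_eq_zero range_proj_of_eq_0_iff)
  moreover have "range_proj_of S = range_proj_of T"
    by (rule range_proj_of_eqI[OF projection_range_proj_of])
      (use pos in \<open>simp add: range_proj_of_eq_0_iff S_def blinfun.bilinear_simps\<close>)
  ultimately show ?thesis unfolding mvn_equiv_iff using v(1) vR vS by auto
qed

subsection \<open>Equivalence of projections\<close>

abbreviation equiv_A (infix \<open>\<simeq>\<close> 50) where "p \<simeq> q \<equiv> mvn_equiv A p q"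

lemma equivI: "v \<in> A \<Longrightarrow> v \<odot> v\<^sup>\<dagger> = p \<Longrightarrow> v\<^sup>\<dagger> \<odot> v = q \<Longrightarrow> p \<simeq> q"
  unfolding mvn_equiv_iff by blast

lemma equiv_sym: "p \<simeq> q \<Longrightarrow> q \<simeq> p"
  unfolding mvn_equiv_iff by (metis hadj_A hadj_hadj)

text \<open>\<open>q \<odot> q\<close> is \<open>v\<^sup>\<dagger> \<odot> p \<odot> v\<close>, and
  \<open>p\<close> is absorbed by \<open>v\<close>.\<close>

lemma equiv_Proj: assumes "p \<simeq> q" "p \<in> Proj A" shows "q \<in> Proj A"
proof -
  obtain v where v: "v \<in> A" "v \<odot> v\<^sup>\<dagger> = p" "v\<^sup>\<dagger> \<odot> v = q" using assms mvn_equiv_iff by blast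
  have pv: "p \<odot> v = v" using partial_isometry_left[OF v(2)] assms(2) Proj_iff by blast
  have "q \<odot> q = q" unfolding v(3)[symmetric] by (simp add: comp_assoc comp_reduce[OF v(2)] pv)
  moreover have "q\<^sup>\<dagger> = q" "q \<in> A" using v by auto
  ultimately show ?thesis by (simp add: Proj_iff projection_def)
qed

lemma equivE:
  assumes "p \<simeq> q" "p \<in> Proj A"
  obtains v where "v \<in> A" "v \<odot> v\<^sup>\<dagger> = p" "v\<^sup>\<dagger> \<odot> v = q" "p \<odot> v = v" "v \<odot> q = v"
    "v\<^sup>\<dagger> \<odot> p = v\<^sup>\<dagger>" "q \<odot> v\<^sup>\<dagger> = v\<^sup>\<dagger>"
proof -
  obtain v where v: "v \<in> A" "v \<odot> v\<^sup>\<dagger> = p" "v\<^sup>\<dagger> \<odot> v = q" using assms mvn_equiv_iff by blast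
  have "projection p" "projection q" using equiv_Proj[OF assms] assms(2) by (auto simp: Proj_iff)
  then show ?thesis using that[OF v] partial_isometry_left[OF v(2)] partial_isometry_right[OF v(3)] by blast
qed

lemma ProjD: assumes "p \<in> Proj A" shows "p \<in> A" "projection p" "p \<odot> p = p" "p\<^sup>\<dagger> = p"
  using assms by (auto simp: Proj_iff projection_def)

lemma equiv_refl: "p \<in> Proj A \<Longrightarrow> p \<simeq> p"
  by (rule equivI[of p]) (auto simp: ProjD)

lemma equiv_trans: assumes "p \<simeq> q" "q \<simeq> r" "p \<in> Proj A" shows "p \<simeq> r"
proof -
  obtain v where v: "v \<in> A" "v \<odot> v\<^sup>\<dagger> = p" "v\<^sup>\<dagger> \<odot> v = q" "v \<odot> q = v"
    using equivE[OF assms(1,3)] by metis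
  obtain w where w: "w \<in> A" "w \<odot> w\<^sup>\<dagger> = q" "w\<^sup>\<dagger> \<odot> w = r" "q \<odot> w = w"
    using equivE[OF assms(2) equiv_Proj[OF assms(1,3)]] by metis
  show ?thesis
    by (rule equivI[of "v \<odot> w"])
      (use v(1) w(1) in \<open>auto simp: comp_assoc comp_reduce[OF w(2)] comp_reduce[OF v(3)] comp_reduce[OF v(4)] v w\<close>)
qed

lemma Proj_diff:
  assumes "p \<in> Proj A" "q \<in> Proj A" "p \<odot> q = p"
  shows "q - p \<in> Proj A" "(q - p) \<odot> p = 0" "p \<odot> (q - p) = 0" "(q - p) \<odot> q = q - p"
proof -
  have "q \<odot> p = p" using projection_comp_swap assms ProjD by blast
  then show "q - p \<in> Proj A" "(q - p) \<odot> p = 0" "p \<odot> (q - p) = 0" "(q - p) \<odot> q = q - p"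
    using assms by (auto simp: Proj_iff projection_def comp_distribs)
qed

lemma Proj_orth_sym: "p \<in> Proj A \<Longrightarrow> q \<in> Proj A \<Longrightarrow> p \<odot> q = 0 \<Longrightarrow> q \<odot> p = 0"
  by (metis ProjD(4) hadj_comp hadj_zero)

lemma Proj_add:
  assumes "p \<in> Proj A" "q \<in> Proj A" "p \<odot> q = 0"
  shows "p + q \<in> Proj A"
  using assms Proj_orth_sym[OF assms] by (auto simp: Proj_iff projection_def comp_distribs)

lemma equiv_add:
  assumes "p \<simeq> q" "p' \<simeq> q'" "p \<in> Proj A" "p' \<in> Proj A" "p \<odot> p' = 0" "q \<odot> q' = 0"
  shows "p + p' \<simeq> q + q'"
proof -
  obtain v where v: "v \<in> A" "v \<odot> v\<^sup>\<dagger> = p" "v\<^sup>\<dagger> \<odot> v = q" "p \<odot> v = v" "v \<odot> q = v"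
    "v\<^sup>\<dagger> \<odot> p = v\<^sup>\<dagger>" "q \<odot> v\<^sup>\<dagger> = v\<^sup>\<dagger>"
    using equivE[OF assms(1,3)] by metis
  obtain w where w: "w \<in> A" "w \<odot> w\<^sup>\<dagger> = p'" "w\<^sup>\<dagger> \<odot> w = q'" "p' \<odot> w = w" "w \<odot> q' = w"
    "w\<^sup>\<dagger> \<odot> p' = w\<^sup>\<dagger>" "q' \<odot> w\<^sup>\<dagger> = w\<^sup>\<dagger>"
    using equivE[OF assms(2,4)] by metis
  \<comment> \<open>Each cross term vanishes once the supports are inserted, since
    \<open>q \<odot> q'\<close> or \<open>p \<odot> p'\<close> then stands between the
    factors.\<close>
  have "v \<odot> w\<^sup>\<dagger> = v \<odot> (q \<odot> q') \<odot> w\<^sup>\<dagger>" by (metis v(5) w(7) comp_assoc)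
  then have 1: "v \<odot> w\<^sup>\<dagger> = 0" by (simp add: assms)
  then have 2: "w \<odot> v\<^sup>\<dagger> = 0" by (metis hadj_comp hadj_hadj hadj_zero)
  have "v\<^sup>\<dagger> \<odot> w = v\<^sup>\<dagger> \<odot> (p \<odot> p') \<odot> w" by (metis v(6) w(4) comp_assoc)
  then have 3: "v\<^sup>\<dagger> \<odot> w = 0" by (simp add: assms)
  then have 4: "w\<^sup>\<dagger> \<odot> v = 0" by (metis hadj_comp hadj_hadj hadj_zero)
  show ?thesis
    by (rule equivI[of "v + w"]) (use v(1) w(1) in \<open>auto simp: comp_distribs 1 2 3 4 v(2,3) w(2,3)\<close>)
qed

text \<open>Conjugation by the partial isometry carries subprojections of \<open>p\<close> to
  subprojections of \<open>q\<close> and, being additive, also their complements.\<close>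

lemma equiv_transport:
  assumes "p \<simeq> q" "p \<in> Proj A" "p' \<in> Proj A" "p' \<odot> p = p'"
  obtains q' where "q' \<in> Proj A" "q' \<odot> q = q'" "p' \<simeq> q'" "p - p' \<simeq> q - q'"
proof -
  obtain v where v: "v \<in> A" "v \<odot> v\<^sup>\<dagger> = p" "v\<^sup>\<dagger> \<odot> v = q" "p \<odot> v = v" "v \<odot> q = v"
    "v\<^sup>\<dagger> \<odot> p = v\<^sup>\<dagger>" "q \<odot> v\<^sup>\<dagger> = v\<^sup>\<dagger>"
    using equivE[OF assms(1,2)] by metis
  have pp: "p \<odot> p' = p'" using projection_comp_swap assms ProjD by blast
  have *: "f \<simeq> v\<^sup>\<dagger> \<odot> f \<odot> v" if "f \<in> Proj A" "f \<odot> p = f" for f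
    by (rule equivI[of "f \<odot> v"])
      (use that v(1) in \<open>auto simp: ProjD comp_assoc comp_reduce[OF v(2)] comp_reduce[OF ProjD(3)] comp_reduce[OF that(2)]\<close>)
  show ?thesis
  proof (rule that)
    show 1: "p' \<simeq> v\<^sup>\<dagger> \<odot> p' \<odot> v" by (rule *[OF assms(3,4)])
    show "v\<^sup>\<dagger> \<odot> p' \<odot> v \<in> Proj A" by (rule equiv_Proj[OF 1 assms(3)])
    show "v\<^sup>\<dagger> \<odot> p' \<odot> v \<odot> q = v\<^sup>\<dagger> \<odot> p' \<odot> v" by (simp add: comp_assoc v)
    have "p - p' \<simeq> v\<^sup>\<dagger> \<odot> (p - p') \<odot> v" using Proj_diff[OF assms(3,2,4)] by (intro *)
    then show "p - p' \<simeq> q - v\<^sup>\<dagger> \<odot> p' \<odot> v" by (simp add: comp_ring v)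
  qed
qed

lemma equiv_0: "p \<simeq> 0 \<Longrightarrow> p = 0"
  unfolding mvn_equiv_iff by (metis blinfun_compose_zero(1) hadj_comp_self_eq_0)

section \<open>Finite projections\<close>

lemma Proj\<^sub>0_iff: "e \<in> Proj\<^sub>0 A \<longleftrightarrow> e \<in> Proj A \<and> (\<forall>p\<in>Proj A. p \<odot> e = p \<and> e \<simeq> p \<longrightarrow> p = e)"
  unfolding Proj\<^sub>0_def subproj_def by auto

lemma finite_Proj: "e \<in> Proj\<^sub>0 A \<Longrightarrow> e \<in> Proj A"
  and finiteD: "e \<in> Proj\<^sub>0 A \<Longrightarrow> p \<odot> e = p \<Longrightarrow> e \<simeq> p \<Longrightarrow> p = e"
  using Proj\<^sub>0_iff equiv_Proj by blast+

text \<open>A subprojection \<open>p\<close> of \<open>f\<close> equivalent to \<open>f\<close> is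
  transported to some \<open>e'\<close> below \<open>e\<close> and equivalent to \<open>e\<close>.
  Then \<open>e - e' = 0\<close>, and \<open>f - p\<close> is equivalent to it.\<close>

lemma finite_equiv: assumes "e \<in> Proj\<^sub>0 A" "e \<simeq> f" shows "f \<in> Proj\<^sub>0 A"
  unfolding Proj\<^sub>0_iff
proof (intro conjI ballI impI; (elim conjE)?)
  have e: "e \<in> Proj A" by (rule finite_Proj[OF assms(1)])
  show f: "f \<in> Proj A" by (rule equiv_Proj[OF assms(2) e])
  have fe: "f \<simeq> e" by (rule equiv_sym[OF assms(2)])
  fix p assume p: "p \<in> Proj A" "p \<odot> f = p" "f \<simeq> p"
  obtain e' where e': "e' \<in> Proj A" "e' \<odot> e = e'" "p \<simeq> e'" "f - p \<simeq> e - e'"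
    using equiv_transport[OF fe f p(1,2)] by metis
  have "e \<simeq> e'" using assms(2) e'(3) p(3) e equiv_trans by blast
  then have "e' = e" using finiteD[OF assms(1)] e' by blast
  then show "p = f" using e'(4) equiv_0 by fastforce
qed

text \<open>Adding \<open>e - f\<close> to both sides turns an equivalence of \<open>f\<close> with
  a part of itself into one of \<open>e\<close> with a part of itself.\<close>

lemma finite_sub: assumes "e \<in> Proj\<^sub>0 A" "f \<in> Proj A" "f \<odot> e = f" shows "f \<in> Proj\<^sub>0 A"
  unfolding Proj\<^sub>0_iff
proof (intro conjI ballI impI; (elim conjE)?)
  have e: "e \<in> Proj A" by (rule finite_Proj[OF assms(1)])
  note d = Proj_diff[OF assms(2) e assms(3)]
  fix p assume p: "p \<in> Proj A" "p \<odot> f = p" "f \<simeq> p"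
  have pd: "p \<odot> (e - f) = 0" using d(3) p(2) by (metis comp_assoc blinfun_compose_zero(2))
  have "f + (e - f) \<simeq> p + (e - f)"
    by (rule equiv_add[OF p(3) equiv_refl[OF d(1)] assms(2) d(1,3) pd])
  moreover have "(p + (e - f)) \<odot> e = p + (e - f)"
  proof -
    have "p \<odot> e = p" by (metis p(2) assms(3) comp_assoc)
    then show ?thesis using d(4) by (simp add: comp_distribs ProjD[OF e] assms(3))
  qed
  ultimately have "p + (e - f) = e" using finiteD[OF assms(1)] by simp
  then show "p = f" by simp
qed (rule assms)

text \<open>The subspace is the range of \<open>p\<close> intersected with the kernel of
  \<open>q\<close>. The adjoint \<open>q \<odot> p\<close> kills exactly the vectors that
  \<open>p\<close> sends into it, which gives the left support of
  \<open>p \<odot> q\<close>.\<close>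

lemma kernel_part_Proj:
  assumes "p \<in> Proj A" "q \<in> Proj A"
  shows "proj {x. p \<cdot> x = x \<and> q \<cdot> x = 0} \<in> Proj A"
    and "proj {x. p \<cdot> x = x \<and> q \<cdot> x = 0} \<odot> p = proj {x. p \<cdot> x = x \<and> q \<cdot> x = 0}"
    and "range_proj_of (p \<odot> q) = p - proj {x. p \<cdot> x = x \<and> q \<cdot> x = 0}"
proof -
  let ?S = "{x. p \<cdot> x = x \<and> q \<cdot> x = 0}"
  have S: "subspace ?S" by (auto simp: subspace_def blinfun.bilinear_simps)
  have cS: "closed ?S" by (intro closed_Collect_conj closed_Collect_eq continuous_intros)
  have "p \<cdot> s \<cdot> x = s \<cdot> p \<cdot> x" "q \<cdot> s \<cdot> x = s \<cdot> q \<cdot> x" if "s \<in> commutant A" for s x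
    using A_commute_apply that assms ProjD(1) by blast+
  then show P: "proj ?S \<in> Proj A" by (intro proj_in_Proj[OF S cS]) auto
  have "p \<odot> proj ?S = proj ?S" using proj_in[OF S cS] by (intro blinfun_eqI) auto
  then have "(p \<odot> proj ?S)\<^sup>\<dagger> = (proj ?S)\<^sup>\<dagger>" by (rule arg_cong)
  then show Pp: "proj ?S \<odot> p = proj ?S" by (simp only: hadj_comp ProjD(4)[OF P] ProjD(4)[OF assms(1)])
  show "range_proj_of (p \<odot> q) = p - proj ?S"
  proof (rule range_proj_of_eqI)
    show "projection (p - proj ?S)" using Proj_diff(1)[OF P assms(1) Pp] ProjD by blast
    fix x
    have "(p - proj ?S) \<cdot> x = 0 \<longleftrightarrow> proj ?S \<cdot> p \<cdot> x = p \<cdot> x"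
      using arg_cong[OF Pp, of "\<lambda>T. T \<cdot> x"] by (auto simp: blinfun.bilinear_simps)
    also have "\<dots> \<longleftrightarrow> p \<cdot> x \<in> ?S" by (rule proj_fixed_iff[OF S cS])
    also have "\<dots> \<longleftrightarrow> (p \<odot> q)\<^sup>\<dagger> \<cdot> x = 0"
      using assms by (simp add: ProjD projection_apply)
    finally show "(p - proj ?S) \<cdot> x = 0 \<longleftrightarrow> (p \<odot> q)\<^sup>\<dagger> \<cdot> x = 0" .
  qed
qed

text \<open>Kaplansky's parallelogram law: the two sides are the left supports of
  \<open>p \<odot> q\<close> and of its adjoint \<open>q \<odot> p\<close>.\<close>

lemma parallelogram_law:
  assumes "p \<in> Proj A" "q \<in> Proj A"
  shows "p - proj {x. p \<cdot> x = x \<and> q \<cdot> x = 0} \<simeq> q - proj {x. q \<cdot> x = x \<and> p \<cdot> x = 0}"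
proof -
  have "(p \<odot> q)\<^sup>\<dagger> = q \<odot> p" using assms by (simp add: ProjD)
  moreover have "p \<odot> q \<in> A" using assms ProjD by blast
  ultimately show ?thesis
    using range_proj_of_equiv[of "p \<odot> q"] kernel_part_Proj(3) assms by simp
qed

subsection \<open>Comparison of projections\<close>

text \<open>Zorn's lemma runs over isometric graphs from \<open>Q\<close> to \<open>P\<close> that
  are invariant under the commutant, for which unions of chains are upper bounds. A nonzero corner
  between the leftovers would, by polar decomposition, enlarge a maximal graph.\<close>

lemma maximal_equiv_parts:
  assumes P: "P \<in> Proj A" and Q: "Q \<in> Proj A"
  obtains v where "v \<in> A" "v \<odot> v\<^sup>\<dagger> \<in> Proj A" "v\<^sup>\<dagger> \<odot> v \<in> Proj A"
    "v \<odot> v\<^sup>\<dagger> \<odot> P = v \<odot> v\<^sup>\<dagger>" "v\<^sup>\<dagger> \<odot> v \<odot> Q = v\<^sup>\<dagger> \<odot> v"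
    "\<And>a. a \<in> A \<Longrightarrow> (P - v \<odot> v\<^sup>\<dagger>) \<odot> a \<odot> (Q - v\<^sup>\<dagger> \<odot> v) = 0"
proof -
  define \<K> where "\<K> = {K :: ('h \<times> 'h) set. subspace K \<and>
    (\<forall>x y. (x, y) \<in> K \<longrightarrow> norm x = norm y \<and> Q \<cdot> x = x \<and> P \<cdot> y = y) \<and>
    (\<forall>s\<in>commutant A. \<forall>x y. (x, y) \<in> K \<longrightarrow> (s \<cdot> x, s \<cdot> y) \<in> K)}"
  have \<K>D: "subspace K" "(x, y) \<in> K \<Longrightarrow> norm x = norm y" "(x, y) \<in> K \<Longrightarrow> Q \<cdot> x = x"
    "(x, y) \<in> K \<Longrightarrow> P \<cdot> y = y" "s \<in> commutant A \<Longrightarrow> (x, y) \<in> K \<Longrightarrow> (s \<cdot> x, s \<cdot> y) \<in> K"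
    if "K \<in> \<K>" for K x y s
    using that unfolding \<K>_def by auto
  have "\<exists>M\<in>\<K>. \<forall>X\<in>\<K>. M \<subseteq> X \<longrightarrow> X = M"
  proof (rule subset_Zorn_nonempty)
    have "{0} \<in> \<K>" by (auto simp: \<K>_def zero_prod_def subspace_def)
    then show "\<K> \<noteq> {}" by blast
  next
    fix \<C> assume ne: "\<C> \<noteq> {}" and ch: "subset.chain \<K> \<C>"
    have sub: "\<C> \<subseteq> \<K>" using ch by (simp add: subset.chain_def)
    have "subspace (\<Union>\<C>)"
    proof (rule subspaceI)
      show "0 \<in> \<Union>\<C>" using ne sub \<K>D(1) subspace_0 by fast
    next
      fix a b assume "a \<in> \<Union>\<C>" "b \<in> \<Union>\<C>"
      then obtain K1 K2 where K12: "K1 \<in> \<C>" "a \<in> K1" "K2 \<in> \<C>" "b \<in> K2" by blast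
      moreover have "K1 \<subseteq> K2 \<or> K2 \<subseteq> K1"
        using ch K12(1,3) unfolding subset.chain_def by blast
      ultimately obtain K where K: "K \<in> \<C>" "a \<in> K" "b \<in> K" by blast
      then have "a + b \<in> K" using sub \<K>D(1) by (intro subspace_add) blast+
      then show "a + b \<in> \<Union>\<C>" using K by blast
    next
      fix c a assume "a \<in> \<Union>\<C>"
      then obtain K where K: "K \<in> \<C>" "a \<in> K" by blast
      then have "c *\<^sub>R a \<in> K" using sub \<K>D(1) by (intro subspace_scale) blast+
      then show "c *\<^sub>R a \<in> \<Union>\<C>" using K by blast
    qed
    moreover have "norm x = norm y \<and> Q \<cdot> x = x \<and> P \<cdot> y = y" if "(x, y) \<in> \<Union>\<C>" for x y
      using that sub \<K>D(2-4) by blast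
    moreover have "(s \<cdot> x, s \<cdot> y) \<in> \<Union>\<C>" if "s \<in> commutant A" "(x, y) \<in> \<Union>\<C>" for s x y
      using that sub \<K>D(5) by blast
    ultimately show "\<Union>\<C> \<in> \<K>" unfolding \<K>_def by blast
  qed
  then obtain K where K: "K \<in> \<K>" and max: "\<And>X. X \<in> \<K> \<Longrightarrow> K \<subseteq> X \<Longrightarrow> X = K" by blast
  obtain v where v: "v \<in> A" "v\<^sup>\<dagger> \<odot> v = proj (closure (fst ` K))" "v \<odot> v\<^sup>\<dagger> = proj (closure (snd ` K))"
    using partial_isometry_of_graph[OF \<K>D(1,2,5)[OF K]] by metis
  have linfst: "linear (fst :: 'h \<times> 'h \<Rightarrow> 'h)" by (simp add: bounded_linear.linear bounded_linear_fst)
  have linsnd: "linear (snd :: 'h \<times> 'h \<Rightarrow> 'h)" by (simp add: bounded_linear.linear bounded_linear_snd)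
  note Sf = subspace_closure[OF linear_subspace_image[OF linfst \<K>D(1)[OF K]]] closed_closure[of "fst ` K"]
  note Ss = subspace_closure[OF linear_subspace_image[OF linsnd \<K>D(1)[OF K]]] closed_closure[of "snd ` K"]
  define q where "q = v\<^sup>\<dagger> \<odot> v"
  define p where "p = v \<odot> v\<^sup>\<dagger>"
  have qA: "q \<in> A" and pA: "p \<in> A" unfolding q_def p_def using v(1) by blast+
  have q: "q \<in> Proj A" using qA projection_proj[OF Sf] v(2) by (simp add: Proj_iff q_def)
  have p: "p \<in> Proj A" using pA projection_proj[OF Ss] v(3) by (simp add: Proj_iff p_def)
  have cl: "closed {x. T \<cdot> x = x}" for T :: "'h \<Rightarrow>\<^sub>L 'h" by (intro closed_Collect_eq continuous_intros)
  have "closure (fst ` K) \<subseteq> {x. Q \<cdot> x = x}"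
    by (rule closure_minimal[OF _ cl]) (use \<K>D(3)[OF K] in auto)
  then have Qq: "Q \<odot> q = q" unfolding q_def v(2) using proj_in[OF Sf] by (intro blinfun_eqI) auto
  have "closure (snd ` K) \<subseteq> {x. P \<cdot> x = x}"
    by (rule closure_minimal[OF _ cl]) (use \<K>D(4)[OF K] in auto)
  then have Pp: "P \<odot> p = p" unfolding p_def v(3) using proj_in[OF Ss] by (intro blinfun_eqI) auto
  have qQ: "q \<odot> Q = q" using arg_cong[OF Qq, of hadj] ProjD[OF q] ProjD[OF Q] by simp
  have pP: "p \<odot> P = p" using arg_cong[OF Pp, of hadj] ProjD[OF p] ProjD[OF P] by simp
  have qK: "q \<cdot> x = x" "p \<cdot> y = y" if "(x, y) \<in> K" for x y
  proof -
    have "x \<in> closure (fst ` K)" "y \<in> closure (snd ` K)"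
      using that by (auto intro!: closure_subset[THEN subsetD] image_eqI[of _ _ "(x, y)"])
    then show "q \<cdot> x = x" "p \<cdot> y = y"
      unfolding q_def p_def v(2,3) proj_fixed_iff[OF Sf] proj_fixed_iff[OF Ss] .
  qed
  note dP = Proj_diff[OF p P pP] and dQ = Proj_diff[OF q Q qQ]
  show ?thesis
  proof (rule that[OF v(1)], unfold p_def[symmetric] q_def[symmetric])
    fix a assume a: "a \<in> A"
    \<comment> \<open>The partial isometry \<open>w\<close> from the polar decomposition of this
      corner has its supports below the leftovers \<open>P - p\<close> and
      \<open>Q - q\<close>.\<close>
    define T where "T = (P - p) \<odot> a \<odot> (Q - q)"
    have TA: "T \<in> A" unfolding T_def using a dP dQ ProjD(1) by blast
    obtain w where w: "w \<in> A" "w \<odot> w\<^sup>\<dagger> = range_proj_of T" "w\<^sup>\<dagger> \<odot> w = range_proj_of (T\<^sup>\<dagger>)"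
      "w \<odot> range_proj_of (T\<^sup>\<dagger>) = w" "range_proj_of T \<odot> w = w"
      using equivE[OF range_proj_of_equiv[OF TA] range_proj_of_in_Proj[OF TA]] by metis
    have "range_proj_of T \<odot> (P - p) = range_proj_of T"
      by (rule range_proj_of_le) (use ProjD[OF dP(1)] in \<open>auto simp: T_def simp flip: comp_assoc\<close>)
    then have "(P - p) \<odot> range_proj_of T = range_proj_of T"
      using projection_comp_swap projection_range_proj_of ProjD[OF dP(1)] by blast
    then have Pw: "(P - p) \<odot> w = w" using w(5) by (metis comp_assoc)
    have "range_proj_of (T\<^sup>\<dagger>) \<odot> (Q - q) = range_proj_of (T\<^sup>\<dagger>)"
      by (rule range_proj_of_le) (use ProjD[OF dQ(1)] ProjD[OF dP(1)] in \<open>auto simp: T_def simp flip: comp_assoc\<close>)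
    then have "w \<odot> (Q - q) = w" using w(4) by (metis comp_assoc)
    then have "(w \<odot> (Q - q))\<^sup>\<dagger> = w\<^sup>\<dagger>" by (rule arg_cong)
    then have Qw: "(Q - q) \<odot> w\<^sup>\<dagger> = w\<^sup>\<dagger>" by (simp only: hadj_comp ProjD(4)[OF dQ(1)])
    have qw: "q \<odot> w\<^sup>\<dagger> = 0" using Qw dQ(3) by (metis comp_assoc blinfun_compose_zero(1))
    have pw: "p \<odot> w = 0" using Pw dP(3) by (metis comp_assoc blinfun_compose_zero(1))
    have Qw': "Q \<odot> w\<^sup>\<dagger> = w\<^sup>\<dagger>" using Qw qw by (simp add: comp_distribs)
    have Pw': "P \<odot> w = w" using Pw pw by (simp add: comp_distribs)
    \<comment> \<open>Parametrizes the graph of \<open>w\<close> on its initial space. Both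
      coordinates are orthogonal to those of \<open>K\<close>, so the sum with \<open>K\<close>
      stays isometric by Pythagoras.\<close>
    define g where "g z = (w\<^sup>\<dagger> \<cdot> z, w \<cdot> w\<^sup>\<dagger> \<cdot> z)" for z
    have gadd: "g y + g z = g (y + z)" and gscale: "r *\<^sub>R g z = g (r *\<^sub>R z)" and g0: "g 0 = 0" for r y z
      by (simp_all add: g_def blinfun.bilinear_simps zero_prod_def)
    have sg: "subspace (range g)"
      unfolding subspace_def using gadd gscale g0 by (auto simp: image_iff)
    define K' where "K' = {a + b | a b. a \<in> K \<and> b \<in> range g}"
    have "K' \<in> \<K>"
      unfolding \<K>_def
    proof (intro CollectI conjI ballI allI impI)
      show "subspace K'" unfolding K'_def by (rule subspace_sums[OF \<K>D(1)[OF K] sg])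
    next
      fix x y assume "(x, y) \<in> K'"
      then obtain x1 y1 z where xy: "(x1, y1) \<in> K" "x = x1 + w\<^sup>\<dagger> \<cdot> z" "y = y1 + w \<cdot> w\<^sup>\<dagger> \<cdot> z"
        unfolding K'_def g_def by auto
      have qz: "q \<cdot> w\<^sup>\<dagger> \<cdot> z = 0" and pz: "p \<cdot> w \<cdot> w\<^sup>\<dagger> \<cdot> z = 0"
        using arg_cong[OF qw, of "\<lambda>T. T \<cdot> z"] arg_cong[OF pw, of "\<lambda>T. T \<cdot> w\<^sup>\<dagger> \<cdot> z"] by auto
      have "inner x1 (w\<^sup>\<dagger> \<cdot> z) = inner (q \<cdot> x1) (w\<^sup>\<dagger> \<cdot> z)" using qK xy(1) by simp
      also have "\<dots> = 0" using qz hadj_left[of q x1] ProjD[OF q] by simp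
      finally have o1: "inner x1 (w\<^sup>\<dagger> \<cdot> z) = 0" .
      have "inner y1 (w \<cdot> w\<^sup>\<dagger> \<cdot> z) = inner (p \<cdot> y1) (w \<cdot> w\<^sup>\<dagger> \<cdot> z)" using qK xy(1) by simp
      also have "\<dots> = 0" using pz hadj_left[of p y1] ProjD[OF p] by simp
      finally have o2: "inner y1 (w \<cdot> w\<^sup>\<dagger> \<cdot> z) = 0" .
      have "w\<^sup>\<dagger> \<odot> w \<odot> w\<^sup>\<dagger> = w\<^sup>\<dagger>"
        using partial_isometry_right(2)[OF w(3) projection_range_proj_of] w(3) by simp
      then have "w\<^sup>\<dagger> \<cdot> w \<cdot> w\<^sup>\<dagger> \<cdot> z = w\<^sup>\<dagger> \<cdot> z" by (metis blinfun_apply_blinfun_compose)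
      then have o3: "inner (w \<cdot> w\<^sup>\<dagger> \<cdot> z) (w \<cdot> w\<^sup>\<dagger> \<cdot> z) = inner (w\<^sup>\<dagger> \<cdot> z) (w\<^sup>\<dagger> \<cdot> z)"
        by (simp flip: hadj_right)
      have "inner x1 x1 = inner y1 y1" using \<K>D(2)[OF K xy(1)] by (simp flip: power2_norm_eq_inner)
      then have "(norm x)\<^sup>2 = (norm y)\<^sup>2"
        unfolding power2_norm_eq_inner xy using o1 o2 o3 by (simp add: inner_simps inner_commute)
      then show "norm x = norm y" by simp
      show "Q \<cdot> x = x" using \<K>D(3)[OF K xy(1)] arg_cong[OF Qw', of "\<lambda>T. T \<cdot> z"]
        unfolding xy by (simp add: blinfun.bilinear_simps)
      show "P \<cdot> y = y" using \<K>D(4)[OF K xy(1)] arg_cong[OF Pw', of "\<lambda>T. T \<cdot> w\<^sup>\<dagger> \<cdot> z"]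
        unfolding xy by (simp add: blinfun.bilinear_simps)
    next
      fix s x y assume s: "s \<in> commutant A" and "(x, y) \<in> K'"
      then obtain x1 y1 z where xy: "(x1, y1) \<in> K" "(x, y) = (x1, y1) + g z"
        unfolding K'_def by fastforce
      have "w\<^sup>\<dagger> \<cdot> s \<cdot> z = s \<cdot> w\<^sup>\<dagger> \<cdot> z" "w \<cdot> s \<cdot> w\<^sup>\<dagger> \<cdot> z = s \<cdot> w \<cdot> w\<^sup>\<dagger> \<cdot> z"
        using A_commute_apply[OF hadj_A[OF w(1)] s] A_commute_apply[OF w(1) s] by auto
      then have "(s \<cdot> x, s \<cdot> y) = (s \<cdot> x1, s \<cdot> y1) + g (s \<cdot> z)"
        using xy(2) by (simp add: g_def blinfun.bilinear_simps)
      then show "(s \<cdot> x, s \<cdot> y) \<in> K'" unfolding K'_def using \<K>D(5)[OF K s xy(1)] by blast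
    qed
    moreover have "K \<subseteq> K'"
    proof
      fix k assume "k \<in> K"
      then have "k = k + g 0" "k \<in> K" "g 0 \<in> range g" using g0 by auto
      then show "k \<in> K'" unfolding K'_def by blast
    qed
    ultimately have KK: "K' = K" by (rule max)
    \<comment> \<open>By maximality \<open>g z\<close> already lies in \<open>K\<close>, so
      \<open>q\<close> fixes its first coordinate; but \<open>q\<close> also annihilates it.\<close>
    have "w\<^sup>\<dagger> \<cdot> z = 0" for z
    proof -
      have "0 + g z \<in> K'" unfolding K'_def using subspace_0[OF \<K>D(1)[OF K]] by blast
      then have "q \<cdot> w\<^sup>\<dagger> \<cdot> z = w\<^sup>\<dagger> \<cdot> z" using qK unfolding KK g_def by simp
      then show ?thesis using arg_cong[OF qw, of "\<lambda>T. T \<cdot> z"] by simp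
    qed
    then have "w\<^sup>\<dagger> = 0" by (intro blinfun_eqI) simp
    then have "range_proj_of T = 0" using w(2) by (metis blinfun_compose_zero(2))
    then show "T = 0" using range_proj_of_comp[of T] by simp
  qed (use p q pP qQ in auto)
qed

text \<open>\<open>z\<close> projects onto the closed span of the vectors
  \<open>a \<cdot> p \<cdot> x\<close>. Invariance under the commutant puts it into
  \<open>A\<close>, invariance under \<open>A\<close> makes it central, and a \<open>q\<close> that
  kills all corners kills the spanning vectors.\<close>

lemma central_support:
  assumes p: "p \<in> Proj A"
  obtains z where "z \<in> Proj A" "\<And>a. a \<in> A \<Longrightarrow> z \<odot> a = a \<odot> z" "z \<odot> p = p"
    "\<And>q. (\<And>a. a \<in> A \<Longrightarrow> q \<odot> a \<odot> p = 0) \<Longrightarrow> q \<odot> z = 0"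
proof -
  define G where "G = {a \<cdot> p \<cdot> x | a x. a \<in> A}"
  define S where "S = closure (span G)"
  have S: "subspace S" "closed S" unfolding S_def by (auto intro: subspace_closure)
  have inv: "T \<cdot> x \<in> S" if T: "\<And>x. x \<in> G \<Longrightarrow> T \<cdot> x \<in> G" and x: "x \<in> S" for T x
    using _ x unfolding S_def
  proof (rule closure_invariant)
    fix y assume "y \<in> span G"
    then have "T \<cdot> y \<in> blinfun_apply T ` span G" by blast
    also have "\<dots> = span (blinfun_apply T ` G)"
      by (rule linear_span_image[OF bounded_linear.linear[OF blinfun.bounded_linear_right], symmetric])
    also have "\<dots> \<subseteq> span G" using T by (intro span_mono) auto
    finally show "T \<cdot> y \<in> span G" .
  qed
  have GS: "G \<subseteq> S" unfolding S_def by (meson closure_subset order_trans span_superset)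
  show ?thesis
  proof (rule that)
    show "proj S \<in> Proj A"
    proof (rule proj_in_Proj[OF S inv])
      fix s x assume s: "s \<in> commutant A" "x \<in> G"
      then obtain a y where "a \<in> A" "x = a \<cdot> p \<cdot> y" unfolding G_def by blast
      then show "s \<cdot> x \<in> G"
        unfolding G_def using A_commute_apply[OF _ s(1)] ProjD(1)[OF p] by (intro CollectI exI[of _ a] exI[of _ "s \<cdot> y"]) auto
    qed
    show "proj S \<odot> a = a \<odot> proj S" if a: "a \<in> A" for a
    proof -
      have "b \<cdot> x \<in> S" if "b \<in> A" "x \<in> S" for b x
        using that(2)
      proof (rule inv[rotated])
        fix y assume "y \<in> G"
        then obtain c u where "c \<in> A" "y = c \<cdot> p \<cdot> u" unfolding G_def by blast
        then show "b \<cdot> y \<in> G"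
          unfolding G_def using that(1) by (intro CollectI exI[of _ "b \<odot> c"] exI[of _ u]) auto
      qed
      then show ?thesis using a by (intro proj_commute[OF S]) auto
    qed
    have "p \<cdot> x \<in> S" for x
    proof -
      have "id_blinfun \<cdot> p \<cdot> x \<in> G" unfolding G_def by blast
      then show ?thesis using GS by auto
    qed
    then show "proj S \<odot> p = p" by (intro blinfun_eqI) (simp add: proj_fixed_iff[OF S])
    fix q assume q: "\<And>a. a \<in> A \<Longrightarrow> q \<odot> a \<odot> p = 0"
    have "q \<cdot> a \<cdot> p \<cdot> x = 0" if "a \<in> A" for a x
      using arg_cong[OF q[OF that], of "\<lambda>T. T \<cdot> x"] by simp
    then have "G \<subseteq> {x. q \<cdot> x = 0}" unfolding G_def by auto
    moreover have "subspace {x. q \<cdot> x = 0}" by (auto simp: subspace_def blinfun.bilinear_simps)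
    moreover have "closed {x. q \<cdot> x = 0}" by (intro closed_Collect_eq continuous_intros)
    ultimately have "S \<subseteq> {x. q \<cdot> x = 0}"
      unfolding S_def by (intro closure_minimal span_minimal)
    then show "q \<odot> proj S = 0" using proj_in[OF S] by (intro blinfun_eqI) auto
  qed
qed

subsection \<open>Cancellation and joins of finite projections\<close>

text \<open>Remove maximal equivalent parts \<open>p\<close> and \<open>q\<close> from the two
  complements. Adding \<open>Y\<close> and \<open>Y'\<close> to them shows that \<open>e - P\<close>
  and \<open>e - Q\<close> are equivalent for the leftovers \<open>P\<close> and \<open>Q\<close>.
  These are centrally separated, so finiteness of \<open>e\<close> forces first \<open>P = 0\<close>
  and then \<open>Q = 0\<close>.\<close>

lemma finite_cancellation:
  assumes e: "e \<in> Proj\<^sub>0 A" and Y: "Y \<in> Proj A" "Y \<odot> e = Y" and Y': "Y' \<in> Proj A" "Y' \<odot> e = Y'"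
    and YY': "Y \<simeq> Y'"
  shows "e - Y \<simeq> e - Y'"
proof -
  have eP: "e \<in> Proj A" by (rule finite_Proj[OF e])
  note dY = Proj_diff[OF Y(1) eP Y(2)] and dY' = Proj_diff[OF Y'(1) eP Y'(2)]
  obtain w where w: "w \<in> A" "w \<odot> w\<^sup>\<dagger> \<in> Proj A" "w\<^sup>\<dagger> \<odot> w \<in> Proj A"
    "w \<odot> w\<^sup>\<dagger> \<odot> (e - Y) = w \<odot> w\<^sup>\<dagger>" "w\<^sup>\<dagger> \<odot> w \<odot> (e - Y') = w\<^sup>\<dagger> \<odot> w"
    and sep: "\<And>a. a \<in> A \<Longrightarrow> (e - Y - w \<odot> w\<^sup>\<dagger>) \<odot> a \<odot> (e - Y' - w\<^sup>\<dagger> \<odot> w) = 0"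
    using maximal_equiv_parts[OF dY(1) dY'(1)] by metis
  define p where "p = w \<odot> w\<^sup>\<dagger>"
  define q where "q = w\<^sup>\<dagger> \<odot> w"
  have p: "p \<in> Proj A" "p \<odot> (e - Y) = p" and q: "q \<in> Proj A" "q \<odot> (e - Y') = q"
    and pq: "p \<simeq> q"
    using w unfolding p_def q_def by (auto intro: equivI)
  define P where "P = e - Y - p"
  define Q where "Q = e - Y' - q"
  note dP = Proj_diff[OF p(1) dY(1) p(2), folded P_def] and dQ = Proj_diff[OF q(1) dY'(1) q(2), folded Q_def]
  have pY: "Y \<odot> p = 0"
    using Proj_orth_sym[OF p(1) Y(1)] p(2) dY(2) by (metis comp_assoc blinfun_compose_zero(2))
  have qY: "Y' \<odot> q = 0"
    using Proj_orth_sym[OF q(1) Y'(1)] q(2) dY'(2) by (metis comp_assoc blinfun_compose_zero(2))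
  have "Y + p \<simeq> Y' + q" by (rule equiv_add[OF YY' pq Y(1) p(1) pY qY])
  then have eq: "e - P \<simeq> e - Q" by (simp add: P_def Q_def add.commute)
  have Pe: "P \<odot> e = P" using dP(4) dY(4) by (metis comp_assoc)
  have Qe: "Q \<odot> e = Q" using dQ(4) dY'(4) by (metis comp_assoc)
  note deP = Proj_diff[OF dP(1) eP Pe] and deQ = Proj_diff[OF dQ(1) eP Qe]
  have P0: "P = 0"
  proof -
    obtain v where v: "v \<in> A" "v \<odot> v\<^sup>\<dagger> = e - P" "v\<^sup>\<dagger> \<odot> v = e - Q" "(e - P) \<odot> v = v" "v \<odot> (e - Q) = v"
      using equivE[OF eq deP(1)] by metis
    obtain z where z: "z \<in> Proj A" "\<And>a. a \<in> A \<Longrightarrow> z \<odot> a = a \<odot> z" "z \<odot> P = P"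
      and zq: "\<And>q. (\<And>a. a \<in> A \<Longrightarrow> q \<odot> a \<odot> P = 0) \<Longrightarrow> q \<odot> z = 0"
      using central_support[OF dP(1)] by metis
    have "Q \<odot> a \<odot> P = 0" if "a \<in> A" for a
    proof -
      have "(P \<odot> a\<^sup>\<dagger> \<odot> Q)\<^sup>\<dagger> = 0" using sep[OF hadj_A[OF that]] unfolding P_def Q_def p_def q_def by simp
      then show ?thesis using ProjD[OF dP(1)] ProjD[OF dQ(1)] by (simp add: comp_assoc)
    qed
    then have "Q \<odot> z = 0" by (rule zq)
    then have zQ: "z \<odot> Q = 0" using z(2) ProjD(1)[OF dQ(1)] by simp
    have ve: "v \<odot> e = v" using v(5) deQ(4) by (metis comp_assoc)
    have "e \<odot> (e - P) = e - P" using projection_comp_swap[OF ProjD(2)[OF deP(1)] ProjD(2)[OF eP] deP(4)] .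
    then have ev: "e \<odot> v = v" using v(4) by (metis comp_assoc)
    have ev': "e \<odot> v\<^sup>\<dagger> = v\<^sup>\<dagger>" using arg_cong[OF ve, of hadj] ProjD[OF eP] by simp
    have ve': "v\<^sup>\<dagger> \<odot> e = v\<^sup>\<dagger>" using arg_cong[OF ev, of hadj] ProjD[OF eP] by simp
    have c: "v \<odot> z = z \<odot> v" "v\<^sup>\<dagger> \<odot> z = z \<odot> v\<^sup>\<dagger>" "e \<odot> z = z \<odot> e"
      using z(2) v(1) hadj_A ProjD(1)[OF eP] by auto
    have c': "a \<odot> (z \<odot> X) = z \<odot> (a \<odot> X)" if "a \<odot> z = z \<odot> a" for a X using that by (metis comp_assoc)
    note [simp] = c c[THEN c'] ve ev ev' ve' comp_reduce[OF ve] comp_reduce[OF ev] comp_reduce[OF ve'] comp_reduce[OF ev']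
      ProjD(3,4)[OF z(1)] comp_reduce[OF ProjD(3)[OF z(1)]] ProjD(3,4)[OF eP] v(2,3) z(3) zQ
    \<comment> \<open>Equal to \<open>v\<close> on the central part \<open>z\<close> and to the
      identity of \<open>e\<close> off it. As \<open>z \<odot> P = P\<close> and
      \<open>z \<odot> Q = 0\<close>, its final projection is \<open>e - P\<close> and its initial
      projection is all of \<open>e\<close>.\<close>
    define t where "t = z \<odot> v + (e - z \<odot> e)"
    have "t \<in> A" unfolding t_def using v(1) ProjD(1)[OF z(1)] ProjD(1)[OF eP] by blast
    moreover have "t \<odot> t\<^sup>\<dagger> = e - P" unfolding t_def by (simp add: comp_ring)
    moreover have "t\<^sup>\<dagger> \<odot> t = e" unfolding t_def by (simp add: comp_ring)
    ultimately have "e - P \<simeq> e" by (rule equivI)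
    then have "e - P = e" using finiteD[OF e deP(4)] equiv_sym by blast
    then show ?thesis by simp
  qed
  then have "e - Q = e" using finiteD[OF e deQ(4)] eq by simp
  then have "Q = 0" by simp
  then have "e - Y' = q" by (simp add: Q_def)
  moreover have "e - Y = p" using P0 by (simp add: P_def)
  ultimately show ?thesis using pq by simp
qed

text \<open>The parallelogram law is applied to the pair \<open>e\<close>, \<open>e'\<close> and to
  their complements in \<open>N\<close>. Both applications leave out the same parts \<open>P\<close>
  and \<open>P'\<close>, so it remains to show these equivalent, which is cancellation inside
  \<open>e'\<close>.\<close>

lemma finite_complement_equiv:
  assumes N: "N \<in> Proj A" and e: "e \<in> Proj\<^sub>0 A" "e \<odot> N = e" and e': "e' \<odot> N = e'" and ee': "e \<simeq> e'"
  shows "N - e \<simeq> N - e'"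
proof -
  have eP: "e \<in> Proj A" by (rule finite_Proj[OF e(1)])
  have e'P: "e' \<in> Proj A" by (rule equiv_Proj[OF ee' eP])
  have e'f: "e' \<in> Proj\<^sub>0 A" by (rule finite_equiv[OF e(1) ee'])
  define f where "f = N - e"
  define f' where "f' = N - e'"
  note df = Proj_diff[OF eP N e(2), folded f_def] and df' = Proj_diff[OF e'P N e', folded f'_def]
  define P where "P = proj {x. e \<cdot> x = x \<and> e' \<cdot> x = 0}"
  define P' where "P' = proj {x. e' \<cdot> x = x \<and> e \<cdot> x = 0}"
  \<comment> \<open>Passing to complements in \<open>N\<close> exchanges the roles of the two
    projections: the vectors of \<open>N - c\<close> killed by \<open>N - b\<close> are those of
    \<open>b\<close> killed by \<open>c\<close>.\<close>
  have set_eq: "{x. (N - c) \<cdot> x = x \<and> (N - b) \<cdot> x = 0} = {x. b \<cdot> x = x \<and> c \<cdot> x = 0}"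
    if b: "b \<in> Proj A" "b \<odot> N = b" and c: "c \<in> Proj A" "c \<odot> N = c" for b c
  proof -
    have Nb: "N \<cdot> b \<cdot> x = b \<cdot> x" and Nc: "N \<cdot> c \<cdot> x = c \<cdot> x" and NN: "N \<cdot> N \<cdot> x = N \<cdot> x" for x
      using projection_comp_swap b c N ProjD(2,3) by (metis blinfun_apply_blinfun_compose)+
    have "(N - c) \<cdot> x = x \<and> (N - b) \<cdot> x = 0 \<longleftrightarrow> b \<cdot> x = x \<and> c \<cdot> x = 0" for x
    proof
      assume "(N - c) \<cdot> x = x \<and> (N - b) \<cdot> x = 0"
      then have x: "N \<cdot> x - c \<cdot> x = x" "N \<cdot> x = b \<cdot> x" by (auto simp: blinfun.bilinear_simps)
      have "N \<cdot> (N \<cdot> x - c \<cdot> x) = N \<cdot> x" using x(1) by simp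
      then have "c \<cdot> x = 0" by (simp add: blinfun.bilinear_simps NN Nc)
      then show "b \<cdot> x = x \<and> c \<cdot> x = 0" using x by simp
    next
      assume "b \<cdot> x = x \<and> c \<cdot> x = 0"
      then show "(N - c) \<cdot> x = x \<and> (N - b) \<cdot> x = 0"
        using Nb[of x] by (simp add: blinfun.bilinear_simps)
    qed
    then show ?thesis by blast
  qed
  have 1: "f' - P \<simeq> f - P'"
    using parallelogram_law[OF df'(1) df(1)] set_eq[OF eP e(2) e'P e'] set_eq[OF e'P e' eP e(2)]
    unfolding f_def f'_def P_def P'_def by simp
  have 2: "e - P \<simeq> e' - P'" unfolding P_def P'_def by (rule parallelogram_law[OF eP e'P])
  have P: "P \<in> Proj A" "P \<odot> e = P" and P': "P' \<in> Proj A" "P' \<odot> e' = P'"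
    using kernel_part_Proj[OF eP e'P] kernel_part_Proj[OF e'P eP] unfolding P_def P'_def by blast+
  have Pf: "P \<odot> f' = P" and Pf': "P' \<odot> f = P'"
    using kernel_part_Proj(2)[OF df'(1) df(1)] kernel_part_Proj(2)[OF df(1) df'(1)]
      set_eq[OF eP e(2) e'P e'] set_eq[OF e'P e' eP e(2)]
    unfolding f_def f'_def P_def P'_def by simp_all
  \<comment> \<open>A copy of \<open>P\<close> inside \<open>e'\<close>. Its complement there is
    equivalent to \<open>e - P\<close>, hence to \<open>e' - P'\<close>, so cancellation applies
    within \<open>e'\<close>.\<close>
  obtain P'' where P'': "P'' \<in> Proj A" "P'' \<odot> e' = P''" "P \<simeq> P''" "e - P \<simeq> e' - P''"
    using equiv_transport[OF ee' eP P] by metis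
  note dP = Proj_diff[OF P(1) eP P(2)] and dP' = Proj_diff[OF P'(1) e'P P'(2)] and dP'' = Proj_diff[OF P''(1) e'P P''(2)]
  have "e' - P'' \<simeq> e' - P'"
    using equiv_trans[OF equiv_sym[OF P''(4)] 2 dP''(1)] .
  from finite_cancellation[OF e'f dP''(1,4) dP'(1,4) this] have "P'' \<simeq> P'" by simp
  then have 3: "P \<simeq> P'" using equiv_trans P''(3) P(1) by blast
  note dPf = Proj_diff[OF P(1) df'(1) Pf] and dPf' = Proj_diff[OF P'(1) df(1) Pf']
  have "(f' - P) + P \<simeq> (f - P') + P'"
    by (rule equiv_add[OF 1 3 dPf(1) P(1) dPf(2) dPf'(2)])
  then show ?thesis unfolding f_def f'_def by (simp add: equiv_sym)
qed

text \<open>Let \<open>e'\<close> be the copy of \<open>e\<close> inside \<open>g\<close>. The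
  complement of \<open>e'\<close> in \<open>e + f\<close> is equivalent to \<open>f\<close>, hence
  finite, and it contains \<open>g - e'\<close>, which is equivalent to \<open>f\<close> too; so the
  two coincide.\<close>

lemma finite_add:
  assumes e: "e \<in> Proj\<^sub>0 A" and f: "f \<in> Proj\<^sub>0 A" and ef: "e \<odot> f = 0"
  shows "e + f \<in> Proj\<^sub>0 A"
  unfolding Proj\<^sub>0_iff
proof (intro conjI ballI impI; (elim conjE)?)
  have eP: "e \<in> Proj A" and fP: "f \<in> Proj A" using e f by (simp_all add: finite_Proj)
  have fe: "f \<odot> e = 0" by (rule Proj_orth_sym[OF eP fP ef])
  show N: "e + f \<in> Proj A" by (rule Proj_add[OF eP fP ef])
  fix g assume g: "g \<in> Proj A" "g \<odot> (e + f) = g" "e + f \<simeq> g"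
  have eN: "e \<odot> (e + f) = e" using ef ProjD[OF eP] by (simp add: comp_distribs)
  obtain e' where e': "e' \<in> Proj A" "e' \<odot> g = e'" "e \<simeq> e'" "e + f - e \<simeq> g - e'"
    using equiv_transport[OF g(3) N eP eN] by metis
  have e'N: "e' \<odot> (e + f) = e'" using e'(2) g(2) by (metis comp_assoc)
  have "e + f - e \<simeq> e + f - e'" by (rule finite_complement_equiv[OF N e eN e'N e'(3)])
  then have 1: "f \<simeq> e + f - e'" by simp
  have 2: "f \<simeq> g - e'" using e'(4) by simp
  have "(g - e') \<odot> (e + f - e') = g - e'"
  proof -
    have "g \<odot> e' = e'" using projection_comp_swap e'(1,2) g(1) ProjD(2) by blast
    then show ?thesis
      unfolding comp_distribs(4)[of _ "e + f" e'] using g(2) e'N ProjD[OF e'(1)] by (simp only: comp_distribs(3)) simp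
  qed
  moreover have "e + f - e' \<simeq> g - e'" using equiv_trans[OF equiv_sym[OF 1] 2] Proj_diff(1)[OF e'(1) N e'N] by blast
  ultimately have "g - e' = e + f - e'" using finiteD[OF finite_equiv[OF f 1]] by blast
  then show "g = e + f" by simp
qed

text \<open>\<open>J\<close> is the join. The parallelogram law makes \<open>J - f\<close>
  equivalent to a part of \<open>e\<close>, so \<open>J\<close> is an orthogonal sum of two finite
  projections.\<close>

lemma finite_upper_bound:
  assumes e: "e \<in> Proj\<^sub>0 A" and f: "f \<in> Proj\<^sub>0 A"
  obtains J where "J \<in> Proj\<^sub>0 A" "J \<odot> e = e" "J \<odot> f = f"
proof -
  have eP: "e \<in> Proj A" and fP: "f \<in> Proj A" using e f by (simp_all add: finite_Proj)
  define J where "J = range_proj_of (e + f)"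
  have J: "J \<in> Proj A" unfolding J_def using eP fP ProjD(1) by (intro range_proj_of_in_Proj) blast
  have ker: "J \<cdot> x = 0 \<longleftrightarrow> e \<cdot> x + f \<cdot> x = 0" for x
    unfolding J_def range_proj_of_eq_0_iff using ProjD[OF eP] ProjD[OF fP] by (simp add: blinfun.bilinear_simps)
  have ker2: "e \<cdot> x = 0 \<and> f \<cdot> x = 0" if "J \<cdot> x = 0" for x
  proof -
    have n: "inner x (p \<cdot> x) = (norm (p \<cdot> x))\<^sup>2" if "p \<in> Proj A" for p
      using hadj_left[of p x "p \<cdot> x"] ProjD[OF that] projection_apply[OF ProjD(2)[OF that]]
      by (simp add: power2_norm_eq_inner)
    have "inner x (e \<cdot> x + f \<cdot> x) = 0" using that ker by simp
    then have "(norm (e \<cdot> x))\<^sup>2 + (norm (f \<cdot> x))\<^sup>2 = 0" using n eP fP by (simp add: inner_simps)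
    then show ?thesis by (simp add: sum_power2_eq_zero_iff)
  qed
  have eJ: "e \<odot> J = e" and fJ: "f \<odot> J = f"
    using ker2 ProjD(2)[OF J] by (auto intro: comp_projection_eqI)
  define g where "g = J - f"
  note dg = Proj_diff[OF fP J fJ, folded g_def]
  \<comment> \<open>A vector of \<open>J - f\<close> killed by \<open>e\<close> is killed by
    \<open>f\<close> as well, hence by \<open>J\<close>, so the parallelogram law leaves out nothing
    of \<open>g\<close>.\<close>
  have "{x. g \<cdot> x = x \<and> e \<cdot> x = 0} = {0}"
  proof (intro set_eqI iffI; clarsimp)
    fix x assume x: "g \<cdot> x = x" "e \<cdot> x = 0"
    have fx: "f \<cdot> x = 0" using arg_cong[OF dg(3), of "\<lambda>T. T \<cdot> x"] x by simp
    then have "J \<cdot> x = 0" using ker x by simp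
    then show "x = 0" using x(1) fx by (simp add: g_def blinfun.bilinear_simps)
  qed
  moreover have "proj {0} = (0 :: 'h \<Rightarrow>\<^sub>L 'h)"
    using proj_in[of "{0 :: 'h}"] by (intro blinfun_eqI) (simp add: subspace_def)
  ultimately have "g \<simeq> e - proj {x. e \<cdot> x = x \<and> g \<cdot> x = 0}"
    using parallelogram_law[OF dg(1) eP] by simp
  moreover have "e - proj {x. e \<cdot> x = x \<and> g \<cdot> x = 0} \<in> Proj\<^sub>0 A"
    using Proj_diff(1,4)[OF kernel_part_Proj(1)[OF eP dg(1)] eP kernel_part_Proj(2)[OF eP dg(1)]]
    by (intro finite_sub[OF e])
  ultimately have "g \<in> Proj\<^sub>0 A" using finite_equiv equiv_sym by blast
  then have "f + g \<in> Proj\<^sub>0 A" using finite_add f dg(3) by blast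
  then have "J \<in> Proj\<^sub>0 A" by (simp add: g_def)
  moreover have "J \<odot> e = e" "J \<odot> f = f"
    using projection_comp_swap eJ fJ ProjD(2) eP fP J by blast+
  ultimately show ?thesis by (rule that)
qed

subsection \<open>The ideal of finite operators\<close>

definition finite_ops :: "('h \<Rightarrow>\<^sub>L 'h) set"
  where "finite_ops = {S \<in> A. range_proj_of S \<in> Proj\<^sub>0 A}"

lemma fin_ideal_eq: "fin_ideal A = closure finite_ops"
proof -
  have "(\<exists>p\<in>Proj\<^sub>0 A. range (blinfun_apply p) = closure (range (blinfun_apply S))) \<longleftrightarrow>
    range_proj_of S \<in> Proj\<^sub>0 A" for S
  proof
    assume "\<exists>p\<in>Proj\<^sub>0 A. range (blinfun_apply p) = closure (range (blinfun_apply S))"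
    then obtain p where p: "p \<in> Proj\<^sub>0 A" "range (blinfun_apply p) = closure (range (blinfun_apply S))" by blast
    then have "p = range_proj_of S"
      using projection_range[of p] finite_Proj ProjD(2) unfolding range_proj_of_def by metis
    then show "range_proj_of S \<in> Proj\<^sub>0 A" using p by simp
  next
    assume "range_proj_of S \<in> Proj\<^sub>0 A"
    then show "\<exists>p\<in>Proj\<^sub>0 A. range (blinfun_apply p) = closure (range (blinfun_apply S))"
      using range_range_proj_of by blast
  qed
  then show ?thesis by (simp add: fin_ideal_def finite_ops_def)
qed

lemma finite_ops_A: "S \<in> finite_ops \<Longrightarrow> S \<in> A"
  by (simp add: finite_ops_def)

lemma finite_opsI: "S \<in> A \<Longrightarrow> p \<in> Proj\<^sub>0 A \<Longrightarrow> p \<odot> S = S \<Longrightarrow> S \<in> finite_ops"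
  unfolding finite_ops_def
  using range_proj_of_le range_proj_of_in_Proj finite_sub finite_Proj ProjD(2) by blast

text \<open>Left and right supports are equivalent, and finiteness passes along equivalence.\<close>

lemma finite_ops_hadj: "S \<in> finite_ops \<Longrightarrow> S\<^sup>\<dagger> \<in> finite_ops"
  unfolding finite_ops_def using finite_equiv range_proj_of_equiv hadj_A by blast

lemma finite_ops_right: "S \<in> finite_ops \<Longrightarrow> T \<in> A \<Longrightarrow> S \<odot> T \<in> finite_ops"
  by (rule finite_opsI[of _ "range_proj_of S"])
    (auto simp: finite_ops_def range_proj_of_comp simp flip: comp_assoc)

lemma finite_ops_left: assumes "S \<in> finite_ops" "T \<in> A" shows "T \<odot> S \<in> finite_ops"
proof -
  have "(S\<^sup>\<dagger> \<odot> T\<^sup>\<dagger>)\<^sup>\<dagger> \<in> finite_ops"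
    by (intro finite_ops_hadj finite_ops_right assms hadj_A)
  then show ?thesis by simp
qed

text \<open>The join of the two left supports is finite and fixes the sum.\<close>

lemma finite_ops_add: assumes "S \<in> finite_ops" "T \<in> finite_ops" shows "S + T \<in> finite_ops"
proof -
  obtain J where J: "J \<in> Proj\<^sub>0 A" "J \<odot> range_proj_of S = range_proj_of S" "J \<odot> range_proj_of T = range_proj_of T"
    using finite_upper_bound assms unfolding finite_ops_def by blast
  have "J \<odot> S = S" "J \<odot> T = T" using J range_proj_of_comp comp_assoc by metis+
  then show ?thesis
    using assms J(1) finite_ops_A by (intro finite_opsI[of _ J]) (auto simp: comp_distribs)
qed

lemma finite_ops_minus: "S \<in> finite_ops \<Longrightarrow> - S \<in> finite_ops"
  using finite_ops_right[of S "- id_blinfun"] by (auto simp: comp_distribs)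

lemma finite_ops_diff: "S \<in> finite_ops \<Longrightarrow> T \<in> finite_ops \<Longrightarrow> S - T \<in> finite_ops"
  using finite_ops_add[of S "- T"] finite_ops_minus by simp

text \<open>If \<open>S\<close> is within distance less than one of \<open>p\<close>, a vector
  \<open>y\<close> of \<open>p\<close> killed by the compressed adjoint satisfies
  \<open>(norm y)\<^sup>2 \<le> norm (p - S) * (norm y)\<^sup>2\<close> and so vanishes. Hence
  \<open>p \<odot> S \<odot> p\<close> has left support \<open>p\<close>.\<close>

lemma Proj_fin_ideal_iff:
  assumes p: "p \<in> Proj A"
  shows "p \<in> fin_ideal A \<longleftrightarrow> p \<in> finite_ops"
proof
  assume "p \<in> finite_ops" then show "p \<in> fin_ideal A"
    unfolding fin_ideal_eq using closure_subset by blast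
next
  assume "p \<in> fin_ideal A"
  then obtain S where S: "S \<in> finite_ops" "norm (S - p) < 1"
    unfolding fin_ideal_eq closure_approachable by (metis dist_norm zero_less_one)
  define T where "T = p \<odot> S \<odot> p"
  have T: "T \<in> finite_ops"
    unfolding T_def using S(1) ProjD(1)[OF p] by (intro finite_ops_right[OF finite_ops_left])
  have "range_proj_of T = p"
  proof (rule range_proj_of_eqI)
    fix x
    have Tx: "T\<^sup>\<dagger> \<cdot> x = p \<cdot> S\<^sup>\<dagger> \<cdot> p \<cdot> x" unfolding T_def using ProjD[OF p] by simp
    show "p \<cdot> x = 0 \<longleftrightarrow> T\<^sup>\<dagger> \<cdot> x = 0"
    proof
      assume "T\<^sup>\<dagger> \<cdot> x = 0"
      define y where "y = p \<cdot> x"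
      have py: "p \<cdot> y = y" unfolding y_def using projection_apply ProjD(2)[OF p] by blast
      have "inner y (S\<^sup>\<dagger> \<cdot> y) = inner y (p \<cdot> S\<^sup>\<dagger> \<cdot> y)" using hadj_left[of p y] ProjD[OF p] py by simp
      also have "\<dots> = 0" using \<open>T\<^sup>\<dagger> \<cdot> x = 0\<close> Tx y_def by simp
      finally have "(norm y)\<^sup>2 = inner y ((p - S)\<^sup>\<dagger> \<cdot> y)"
        using py ProjD[OF p] by (simp add: power2_norm_eq_inner blinfun.bilinear_simps inner_simps)
      also have "\<dots> \<le> norm y * norm ((p - S)\<^sup>\<dagger> \<cdot> y)" by (rule norm_cauchy_schwarz)
      also have "\<dots> \<le> norm y * (norm (p - S) * norm y)"
        using norm_blinfun[of "(p - S)\<^sup>\<dagger>" y] by (intro mult_left_mono) (simp_all only: norm_hadj norm_ge_zero)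
      finally have "1 * (norm y)\<^sup>2 \<le> norm (p - S) * (norm y)\<^sup>2" by (simp add: power2_eq_square mult_ac)
      moreover have "norm (p - S) < 1" using S(2) by (simp add: norm_minus_commute)
      ultimately have "(norm y)\<^sup>2 = 0" by (metis mult_le_cancel_right not_le zero_le_power2 order_antisym)
      then show "p \<cdot> x = 0" by (simp add: y_def)
    qed (simp add: Tx)
  qed (rule ProjD(2)[OF p])
  then show "p \<in> finite_ops"
    using T p ProjD range_proj_of_projection[OF ProjD(2)[OF p]] by (simp add: finite_ops_def)
qed

text \<open>A finite \<open>r\<close> dominates both supports of \<open>k\<close>. Injectivity makes
  \<open>r\<close> the right support of \<open>r + k\<close>; the left support is equivalent to it
  and lies below it, hence equals \<open>r\<close> by finiteness. As \<open>y\<close> lies in the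
  range of \<open>r\<close> and is killed by the adjoint of \<open>r + k\<close>, it is
  zero.\<close>

lemma fredholm_alternative:
  assumes k: "k \<in> finite_ops" and inj: "\<And>x. x + k \<cdot> x = 0 \<Longrightarrow> x = 0"
    and y: "y + k\<^sup>\<dagger> \<cdot> y = 0"
  shows "y = 0"
proof -
  have kA: "k \<in> A" by (rule finite_ops_A[OF k])
  obtain r where r: "r \<in> Proj\<^sub>0 A" "r \<odot> range_proj_of k = range_proj_of k"
      "r \<odot> range_proj_of (k\<^sup>\<dagger>) = range_proj_of (k\<^sup>\<dagger>)"
    using finite_upper_bound k finite_ops_hadj[OF k] unfolding finite_ops_def by blast
  have rP: "r \<in> Proj A" by (rule finite_Proj[OF r(1)])
  have rk: "r \<odot> k = k" using r(2) range_proj_of_comp comp_assoc by metis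
  have rk': "r \<odot> k\<^sup>\<dagger> = k\<^sup>\<dagger>" using r(3) range_proj_of_comp comp_assoc by metis
  have kr: "k \<odot> r = k" using arg_cong[OF rk', of hadj] ProjD[OF rP] by simp
  have krx: "k \<cdot> r \<cdot> x = k \<cdot> x" for x using arg_cong[OF kr, of "\<lambda>T. T \<cdot> x"] by simp
  have 1: "range_proj_of ((r + k)\<^sup>\<dagger>) = r"
  proof (rule range_proj_of_eqI[OF ProjD(2)[OF rP]])
    fix x show "r \<cdot> x = 0 \<longleftrightarrow> (r + k)\<^sup>\<dagger>\<^sup>\<dagger> \<cdot> x = 0"
      using inj[of "r \<cdot> x"] krx[of x] by (auto simp: blinfun.bilinear_simps)
  qed
  have "r + k \<in> A" using ProjD(1)[OF rP] kA by blast
  from range_proj_of_equiv[OF this] have "r \<simeq> range_proj_of (r + k)" unfolding 1 by (rule equiv_sym)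
  moreover have "range_proj_of (r + k) \<odot> r = range_proj_of (r + k)"
    by (rule range_proj_of_le) (use ProjD[OF rP] rk in \<open>auto simp: comp_distribs\<close>)
  ultimately have 2: "range_proj_of (r + k) = r" using finiteD[OF r(1)] by blast
  have ky: "k\<^sup>\<dagger> \<cdot> y = - y" using y by (metis add.commute add_eq_0_iff)
  then have ry: "r \<cdot> y = y"
    using arg_cong[OF rk', of "\<lambda>T. T \<cdot> y"] by (simp add: blinfun.bilinear_simps)
  then have "(r + k)\<^sup>\<dagger> \<cdot> y = 0" using y ProjD[OF rP] by (simp add: blinfun.bilinear_simps)
  then have "range_proj_of (r + k) \<cdot> y = 0" by (simp only: range_proj_of_eq_0_iff)
  then show ?thesis using 2 ry by simp
qed

text \<open>Besides the absorption rules of the corner and its inverse, this records in the last two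
  equations that \<open>b\<close> inverts \<open>a\<close> from the left modulo multiples of
  \<open>p\<close> and from the right modulo multiples of \<open>q\<close>.\<close>

lemma invertible_uptoE:
  assumes "invertible_upto A a p q" "p \<in> Proj A" "q \<in> Proj A"
  obtains a' b where "b \<in> A" "a' = a - q \<odot> a - a \<odot> p + q \<odot> a \<odot> p" "a' \<odot> b = id_blinfun - q" "b \<odot> a' = id_blinfun - p"
    "p \<odot> b = 0" "b \<odot> q = 0" "q \<odot> a' = 0" "a' \<odot> p = 0"
    "b \<odot> a - id_blinfun = b \<odot> a \<odot> p - p" "a \<odot> b - id_blinfun = q \<odot> a \<odot> b - q"
proof -
  define a' where "a' = (id_blinfun - q) \<odot> a \<odot> (id_blinfun - p)"
  obtain b where b: "b \<in> A" "b = (id_blinfun - p) \<odot> b \<odot> (id_blinfun - q)"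
      "a' \<odot> b = id_blinfun - q" "b \<odot> a' = id_blinfun - p"
    using assms(1) unfolding invertible_upto_def Let_def a'_def by blast
  note [simp] = ProjD(3)[OF assms(2)] ProjD(3)[OF assms(3)] comp_reduce[OF ProjD(3)[OF assms(2)]]
    comp_reduce[OF ProjD(3)[OF assms(3)]]
  have pb: "p \<odot> b = 0" by (subst b(2)) (simp add: comp_ring)
  have bq: "b \<odot> q = 0" by (subst b(2)) (simp add: comp_ring)
  show ?thesis
  proof (rule that[OF b(1) _ b(3,4) pb bq])
    show "a' = a - q \<odot> a - a \<odot> p + q \<odot> a \<odot> p" by (simp add: a'_def comp_ring)
    show "q \<odot> a' = 0" "a' \<odot> p = 0" by (simp_all add: a'_def comp_ring)
    have "b \<odot> a' = b \<odot> a - b \<odot> a \<odot> p" by (simp add: a'_def comp_ring comp_reduce[OF bq])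
    then show "b \<odot> a - id_blinfun = b \<odot> a \<odot> p - p" using b(4) by (simp add: algebra_simps)
    have "a' \<odot> b = a \<odot> b - q \<odot> a \<odot> b" by (simp add: a'_def comp_ring pb)
    then show "a \<odot> b - id_blinfun = q \<odot> a \<odot> b - q" using b(3) by (simp add: algebra_simps)
  qed
qed

text \<open>Modulo finite operators \<open>b\<close> and \<open>c\<close> are a left and a right
  inverse of \<open>a\<close>, hence agree; so \<open>q\<close> is congruent to
  \<open>a \<odot> b \<odot> q\<close>, which is zero.\<close>

lemma finite_ops_of_left_inverse_annihilator:
  assumes A: "a \<in> A" "b \<in> A" "c \<in> A" "q \<in> A"
    and "b \<odot> a - id_blinfun \<in> finite_ops" "a \<odot> c - id_blinfun \<in> finite_ops" "b \<odot> q = 0"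
  shows "q \<in> finite_ops"
proof -
  have "q = a \<odot> (b \<odot> (a \<odot> c - id_blinfun) - (b \<odot> a - id_blinfun) \<odot> c) \<odot> q - (a \<odot> c - id_blinfun) \<odot> q"
    by (simp add: comp_ring assms(7))
  moreover have "\<dots> \<in> finite_ops"
    by (rule finite_ops_diff[OF finite_ops_right[OF finite_ops_left[OF finite_ops_diff[OF
            finite_ops_left[OF assms(6) A(2)] finite_ops_right[OF assms(5) A(3)]] A(1)] A(4)]
          finite_ops_right[OF assms(6) A(4)]])
  ultimately show ?thesis by simp
qed

section \<open>The semi-Weyl and Fredholm conditions combined\<close>

lemma Weyl_of_semi_Weyl:
  assumes a: "a \<in> K\<Phi>_upper_semi_Weyl A" "a \<in> K\<Phi>_lower_semi_Weyl A" "a \<in> K\<Phi> A"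
  shows "a \<in> K\<Phi>\<^sub>0 A"
proof -
  obtain p1 q1 where 1: "p1 \<in> Proj A" "q1 \<in> Proj A" "invertible_upto A a p1 q1" "p1 \<in> fin_ideal A" "mvn_le A p1 q1"
    using a(1) unfolding K\<Phi>_upper_semi_Weyl_def by blast
  obtain p2 q2 where 2: "p2 \<in> Proj A" "q2 \<in> Proj A" "invertible_upto A a p2 q2" "q2 \<in> fin_ideal A" "mvn_le A q2 p2"
    using a(2) unfolding K\<Phi>_lower_semi_Weyl_def by blast
  obtain p3 q3 where 3: "p3 \<in> Proj A" "q3 \<in> Proj A" "invertible_upto A a p3 q3" "q3 \<in> fin_ideal A"
    and aA: "a \<in> A"
    using a(3) unfolding K\<Phi>_def by blast
  have fin: "p1 \<in> finite_ops" "q2 \<in> finite_ops" "q3 \<in> finite_ops"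
    using 1 2 3 Proj_fin_ideal_iff by blast+
  obtain a1 b1 where b1: "b1 \<in> A" "a1 = a - q1 \<odot> a - a \<odot> p1 + q1 \<odot> a \<odot> p1" "b1 \<odot> a1 = id_blinfun - p1"
      "b1 \<odot> q1 = 0" "q1 \<odot> a1 = 0" "b1 \<odot> a - id_blinfun = b1 \<odot> a \<odot> p1 - p1"
    using invertible_uptoE[OF 1(3,1,2)] by metis
  obtain a2 b2 where b2: "b2 \<in> A" "a2 \<odot> b2 = id_blinfun - q2" "p2 \<odot> b2 = 0" "a2 \<odot> p2 = 0"
      "a \<odot> b2 - id_blinfun = q2 \<odot> a \<odot> b2 - q2"
    using invertible_uptoE[OF 2(3,1,2)] by metis
  obtain b3 where b3: "b3 \<in> A" "a \<odot> b3 - id_blinfun = q3 \<odot> a \<odot> b3 - q3"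
    using invertible_uptoE[OF 3(3,1,2)] by metis
  \<comment> \<open>\<open>b1\<close> is a left inverse of \<open>a\<close> modulo finite operators
    and annihilates \<open>q1\<close>; the Fredholm condition supplies the right inverse
    \<open>b3\<close>.\<close>
  have q1: "q1 \<in> finite_ops"
  proof (rule finite_ops_of_left_inverse_annihilator[OF aA b1(1) b3(1) ProjD(1)[OF 1(2)] _ _ b1(4)])
    show "b1 \<odot> a - id_blinfun \<in> finite_ops"
      unfolding b1(6) using fin(1) aA b1(1) by (intro finite_ops_diff finite_ops_left) auto
    show "a \<odot> b3 - id_blinfun \<in> finite_ops"
      unfolding b3(2) using fin(3) aA b3(1) by (intro finite_ops_diff finite_ops_right) auto
  qed
  obtain p' where p': "p' \<in> Proj A" "p' \<odot> q1 = p'" "p1 \<simeq> p'"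
    using 1(5) unfolding mvn_le_def subproj_def by blast
  obtain v where v: "v \<in> A" "v \<odot> v\<^sup>\<dagger> = p1" "v \<odot> p' = v" "p' \<odot> v\<^sup>\<dagger> = v\<^sup>\<dagger>" "v\<^sup>\<dagger> \<odot> p1 = v\<^sup>\<dagger>"
    using equivE[OF p'(3) 1(1)] by metis
  obtain p'' where p'': "p'' \<in> Proj A" "p'' \<odot> p2 = p''" "q2 \<simeq> p''"
    using 2(5) unfolding mvn_le_def subproj_def by blast
  obtain w where w: "w \<in> A" "w \<odot> w\<^sup>\<dagger> = q2" "w \<odot> p'' = w" "p'' \<odot> w\<^sup>\<dagger> = w\<^sup>\<dagger>" "w\<^sup>\<dagger> \<odot> q2 = w\<^sup>\<dagger>"
    using equivE[OF p''(3) 2(2)] by metis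
  have q1p': "q1 \<odot> p' = p'" using projection_comp_swap[OF ProjD(2)[OF p'(1)] ProjD(2)[OF 1(2)] p'(2)] .
  have p2p'': "p2 \<odot> p'' = p''" using projection_comp_swap[OF ProjD(2)[OF p''(1)] ProjD(2)[OF 2(1)] p''(2)] .
  have vq: "v \<odot> q1 = v" "q1 \<odot> v\<^sup>\<dagger> = v\<^sup>\<dagger>" using v(3,4) p'(2) q1p' by (metis comp_assoc)+
  have wp: "w \<odot> p2 = w" "p2 \<odot> w\<^sup>\<dagger> = w\<^sup>\<dagger>" using w(3,4) p''(2) p2p'' by (metis comp_assoc)+
  \<comment> \<open>\<open>a1\<close> is invertible from the complement of \<open>p1\<close> to that
    of \<open>q1\<close>, and the adjoint of \<open>v\<close> carries \<open>p1\<close> onto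
    \<open>p'\<close> below \<open>q1\<close>. So \<open>b1 + v\<close> is a left inverse, and only
    \<open>q1 - p'\<close> is missed.\<close>
  define c where "c = a1 + v\<^sup>\<dagger>"
  \<comment> \<open>Likewise \<open>b2\<close> embeds the complement of \<open>q2\<close> onto that
    of \<open>p2\<close>, and the adjoint of \<open>w\<close> carries \<open>q2\<close> onto
    \<open>p''\<close> below \<open>p2\<close>; the left inverse is \<open>a2 + w\<close>.\<close>
  define d where "d = b2 + w\<^sup>\<dagger>"
  have va1: "v \<odot> a1 = 0" using vq(1) b1(5) by (metis comp_assoc blinfun_compose_zero(2))
  have b1v: "b1 \<odot> v\<^sup>\<dagger> = 0" using vq(2) b1(4) by (metis comp_assoc blinfun_compose_zero(1))
  have wb2: "w \<odot> b2 = 0" using wp(1) b2(3) by (metis comp_assoc blinfun_compose_zero(2))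
  have a2w: "a2 \<odot> w\<^sup>\<dagger> = 0" using wp(2) b2(4) by (metis comp_assoc blinfun_compose_zero(1))
  have cl: "(b1 + v) \<odot> c = id_blinfun" unfolding c_def by (simp add: comp_distribs va1 b1v b1(3) v(2))
  have dl: "(a2 + w) \<odot> d = id_blinfun" unfolding d_def by (simp add: comp_distribs wb2 a2w b2(2) w(2))
  have dA: "d \<in> A" unfolding d_def using b2(1) w(1) hadj_A by blast
  define k where "k = c \<odot> d - id_blinfun"
  \<comment> \<open>\<open>c\<close> is replaced by \<open>a\<close>, and then
    \<open>a \<odot> d - id_blinfun\<close> is split along the two summands of \<open>d\<close>.
    Writing the adjoint of \<open>w\<close> with the factor \<open>q2\<close> exposes its
    finiteness.\<close>
  have "k = (c - a) \<odot> d + ((a \<odot> b2 - id_blinfun) + a \<odot> (w\<^sup>\<dagger> \<odot> q2))"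
    unfolding k_def w(5) by (simp add: d_def comp_ring)
  also have "c - a = q1 \<odot> a \<odot> p1 - q1 \<odot> a - a \<odot> p1 + v\<^sup>\<dagger> \<odot> p1"
    unfolding c_def b1(2) v(5) by simp
  finally have "k = (q1 \<odot> a \<odot> p1 - q1 \<odot> a - a \<odot> p1 + v\<^sup>\<dagger> \<odot> p1) \<odot> d +
      ((q2 \<odot> a \<odot> b2 - q2) + a \<odot> (w\<^sup>\<dagger> \<odot> q2))"
    unfolding b2(5) .
  also have "\<dots> \<in> finite_ops"
  proof -
    have "q1 \<odot> a \<in> finite_ops" by (rule finite_ops_right[OF q1 aA])
    moreover have "q1 \<odot> a \<odot> p1 \<in> finite_ops" by (rule finite_ops_right[OF calculation ProjD(1)[OF 1(1)]])
    moreover have "a \<odot> p1 \<in> finite_ops" "v\<^sup>\<dagger> \<odot> p1 \<in> finite_ops"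
      using fin(1) aA v(1) hadj_A by (auto intro: finite_ops_left)
    moreover have "a \<odot> (w\<^sup>\<dagger> \<odot> q2) \<in> finite_ops"
      using fin(2) aA w(1) hadj_A by (auto intro: finite_ops_left)
    moreover have "q2 \<odot> a \<odot> b2 \<in> finite_ops"
      using fin(2) aA b2(1) by (auto intro: finite_ops_right)
    ultimately show ?thesis
      using fin(2) dA by (intro finite_ops_add[OF finite_ops_right] finite_ops_add finite_ops_diff)
  qed
  finally have k: "k \<in> finite_ops" .
  have kx: "x + k \<cdot> x = c \<cdot> d \<cdot> x" for x by (simp add: k_def blinfun.bilinear_simps)
  \<comment> \<open>Both \<open>c\<close> and \<open>d\<close> have left inverses.\<close>
  have inj: "x = 0" if "x + k \<cdot> x = 0" for x
  proof -
    have "((b1 + v) \<odot> c) \<cdot> d \<cdot> x = 0" using that unfolding kx by simp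
    then have "d \<cdot> x = 0" unfolding cl by simp
    then have "((a2 + w) \<odot> d) \<cdot> x = 0" by simp
    then show ?thesis unfolding dl by simp
  qed
  define s where "s = q1 - p'"
  note ds = Proj_diff[OF p'(1) 1(2) p'(2), folded s_def]
  have "s \<odot> a1 = 0" using ds(4) b1(5) by (metis comp_assoc blinfun_compose_zero(2))
  moreover have "s \<odot> v\<^sup>\<dagger> = 0" unfolding s_def by (simp add: comp_distribs vq v)
  ultimately have sc: "s \<odot> c = 0" by (simp add: c_def comp_distribs)
  \<comment> \<open>From \<open>s \<odot> c = 0\<close> it follows that \<open>s\<close> annihilates
    \<open>id_blinfun + k\<close> from the left; after adjoints, every \<open>s \<cdot> x\<close>
    lies in the kernel of \<open>id_blinfun + k\<^sup>\<dagger>\<close>, which is trivial.\<close>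
  have "s \<cdot> x = 0" for x
  proof (rule fredholm_alternative[OF k inj])
    have "s \<odot> (id_blinfun + k) = s \<odot> c \<odot> d" by (simp add: k_def comp_ring)
    also have "\<dots> = 0" by (simp add: sc)
    finally have "(s \<odot> (id_blinfun + k))\<^sup>\<dagger> = 0" by simp
    then have "s + k\<^sup>\<dagger> \<odot> s = 0" using ProjD[OF ds(1)] by (simp add: comp_distribs)
    from arg_cong[OF this, of "\<lambda>T. T \<cdot> x"] show "s \<cdot> x + k\<^sup>\<dagger> \<cdot> s \<cdot> x = 0"
      by (simp add: blinfun.bilinear_simps)
  qed
  then have "s = 0" by (intro blinfun_eqI) simp
  then have "p1 \<simeq> q1" using p'(3) by (simp add: s_def)
  moreover have "q1 \<in> fin_ideal A" using q1 Proj_fin_ideal_iff 1(2) by blast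
  ultimately show ?thesis unfolding K\<Phi>\<^sub>0_def using aA 1 by blast
qed

lemma semi_Weyl_of_Weyl:
  assumes "a \<in> K\<Phi>\<^sub>0 A"
  shows "a \<in> K\<Phi>_upper_semi_Weyl A" "a \<in> K\<Phi>_lower_semi_Weyl A" "a \<in> K\<Phi> A"
proof -
  obtain p q where pq: "a \<in> A" "p \<in> Proj A" "q \<in> Proj A" "invertible_upto A a p q"
      "p \<in> fin_ideal A" "q \<in> fin_ideal A" "p \<simeq> q"
    using assms unfolding K\<Phi>\<^sub>0_def by blast
  have "mvn_le A p q" "mvn_le A q p"
    unfolding mvn_le_def subproj_def using pq equiv_sym ProjD(3) by blast+
  then show "a \<in> K\<Phi>_upper_semi_Weyl A" "a \<in> K\<Phi>_lower_semi_Weyl A" "a \<in> K\<Phi> A"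
    using pq unfolding K\<Phi>_upper_semi_Weyl_def K\<Phi>_lower_semi_Weyl_def K\<Phi>_def by blast+
qed

end

theorem corollary4p8:
  fixes A :: "('h::complex_hilbert \<Rightarrow>\<^sub>L 'h) set"
  assumes "von_neumann_algebra A"
    and "properly_infinite A"
  shows "K\<Phi>_upper_semi_Weyl A \<inter> K\<Phi>_lower_semi_Weyl A \<inter> K\<Phi> A = K\<Phi>\<^sub>0 A"
proof -
  interpret vn_algebra A by standard (rule assms(1))
  show ?thesis using Weyl_of_semi_Weyl semi_Weyl_of_Weyl by blast
qed

end
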